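(* Let $M\in\mathbb R^{n\times n}$ be sufficient, $Q\in\mathbb R^{n\times d}$ of rank $d$, $q\in\mathbb R^n$, $S=\{q+Q\theta:\theta\in\mathbb R^d\}$, $S^\epsilon=S+\boldsymbol\epsilon$, and let $V^\epsilon$, $E^\epsilon$, $V$ be as defined below. Let $B_1,B_2\in V$ be distinct with $\dim(S_{B_1}\cap S_{B_2})=d-1$. Then there exist $\tilde B^1,\dots,\tilde B^r\in V^\epsilon$ with $\tilde B^1=B_1$, $\tilde B^r=B_2$, $\{\tilde B^k,\tilde B^{k+1}\}\in E^\epsilon$ for $k=1,\dots,r-1$, and $\dim(S_{\tilde B^k}\cap S_{B_1}\cap S_{B_2})=d-1$ for all $k=1,\dots,r$.
   Context: $\boldsymbol\epsilon=(\epsilon,\epsilon^2,\dots,\epsilon^n)^T$. Let $A=[\,I\;\;-M\,]\in\mathbb R^{n\times 2n}$, columns indexed by $\{1,\dots,2n\}$; $A_{\cdot J}$ is the submatrix of columns indexed by $J$. Complementary index: $\bar i=i+n$ if $i\le n$, $\bar i=i-n$ if $i>n$. A set $J$ is complementary if $i\in J\Rightarrow\bar i\notin J$. A complementary basis is a complementary set $B$ with $|B|=n$ and $A_{\cdot B}$ invertible. Complementary cone: $\mathcal C(J)=\{A_{\cdot J}\lambda:\lambda\ge0\}$. Critical domain: $S_B=\mathcal C(B)\cap S$. Dimension of a convex set = dimension of its affine hull. $V^\epsilon$ is the set of complementary bases $B$ for which there is $\delta>0$ with $\dim(\mathcal C(B)\cap S^\epsilon)=d$ for all $\epsilon\in(0,\delta)$;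 $E^\epsilon$ is the set of pairs $\{B,B'\}$ of distinct elements of $V^\epsilon$ for which there is $\delta>0$ with $\dim(\mathcal C(B)\cap\mathcal C(B')\cap S^\epsilon)=d-1$ for all $\epsilon\in(0,\delta)$; $V=\{B\in V^\epsilon:\dim S_B=d\}$. $M$ is column sufficient if $[z_i(Mz)_i\le 0\ \forall i]\Rightarrow[z_i(Mz)_i=0\ \forall i]$; row sufficient if $M^T$ is column sufficient; sufficient if both. *)

theory Defs
  imports "HOL-Analysis.Analysis"
begin

type_synonym 'n rvec = "(real, 'n) vec"
type_synonym ('m, 'n) rmat = "((real, 'n) vec, 'm) vec"  (* 'm rows, 'n columns *)

text \<open>Vectors of R^n are 'n rvec for a finite linearly ordered index type 'n; the order
  fixes the numbering 1..n of the coordinates (coordinate i has number card {j. j \<le> i}).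
  Columns of A = [I, -M] are indexed by 'n + 'n: Inl i is column i of I,
  Inr i is column i of -M (i.e. the paper's column i+n). The complementary index of
  Inl i is Inr i and vice versa.\<close>

definition column_sufficient :: "('n::finite, 'n) rmat \<Rightarrow> bool" where
  "column_sufficient M \<longleftrightarrow>
     (\<forall>z::'n rvec. (\<forall>i. z$i * (M *v z)$i \<le> 0) \<longrightarrow> (\<forall>i. z$i * (M *v z)$i = 0))"

definition row_sufficient :: "('n::finite, 'n) rmat \<Rightarrow> bool" where
  "row_sufficient M \<longleftrightarrow> column_sufficient (transpose M)"

definition sufficient :: "('n::finite, 'n) rmat \<Rightarrow> bool" where
  "sufficient M \<longleftrightarrow> column_sufficient M \<and> row_sufficient M"

definition Acol :: "('n::finite, 'n) rmat \<Rightarrow> ('n + 'n) \<Rightarrow> 'n rvec" where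
  "Acol M j = (case j of Inl i \<Rightarrow> axis i 1 | Inr i \<Rightarrow> - column i M)"

definition compl_idx :: "('n::finite + 'n) \<Rightarrow> ('n + 'n)" where
  "compl_idx j = (case j of Inl i \<Rightarrow> Inr i | Inr i \<Rightarrow> Inl i)"

definition complementary :: "('n::finite + 'n) set \<Rightarrow> bool" where
  "complementary J \<longleftrightarrow> (\<forall>j\<in>J. compl_idx j \<notin> J)"

text \<open>A_{.B} (an n x n matrix, as |B| = n) is invertible iff its n columns are
  pairwise distinct and linearly independent.\<close>
definition compl_basis :: "('n::finite, 'n) rmat \<Rightarrow> ('n + 'n) set \<Rightarrow> bool" where
  "compl_basis M B \<longleftrightarrow> complementary B \<and> card B = CARD('n) \<and>
     inj_on (Acol M) B \<and> independent (Acol M ` B)"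

definition compl_cone :: "('n::finite, 'n) rmat \<Rightarrow> ('n + 'n) set \<Rightarrow> ('n rvec) set" where
  "compl_cone M J = {(\<Sum>j\<in>J. c j *\<^sub>R Acol M j) | c. \<forall>j\<in>J. c j \<ge> 0}"

definition Sset :: "('n::finite, 'd::finite) rmat \<Rightarrow> 'n rvec \<Rightarrow> ('n rvec) set" where
  "Sset Q q = {q + Q *v \<theta> | \<theta>. True}"

definition eps_vec :: "real \<Rightarrow> 'n::{finite,linorder} rvec" where
  "eps_vec \<epsilon> = (\<chi> i. \<epsilon> ^ card {j. j \<le> i})"

definition Seps :: "('n, 'd::finite) rmat \<Rightarrow> 'n rvec \<Rightarrow> real \<Rightarrow> 'n::{finite,linorder} rvec set" where
  "Seps Q q \<epsilon> = (\<lambda>x. x + eps_vec \<epsilon>) ` Sset Q q"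

definition crit_dom :: "('n::finite, 'n) rmat \<Rightarrow> ('n, 'd::finite) rmat \<Rightarrow> 'n rvec \<Rightarrow> ('n + 'n) set \<Rightarrow> ('n rvec) set" where
  "crit_dom M Q q B = compl_cone M B \<inter> Sset Q q"

definition Veps :: "('n::{finite,linorder}, 'n) rmat \<Rightarrow> ('n, 'd::finite) rmat \<Rightarrow> 'n rvec \<Rightarrow> ('n + 'n) set set" where
  "Veps M Q q = {B. compl_basis M B \<and> (\<exists>\<delta>>0. \<forall>\<epsilon>. 0 < \<epsilon> \<and> \<epsilon> < \<delta> \<longrightarrow>
       aff_dim (compl_cone M B \<inter> Seps Q q \<epsilon>) = int CARD('d))}"

definition Eeps :: "('n::{finite,linorder}, 'n) rmat \<Rightarrow> ('n, 'd::finite) rmat \<Rightarrow> 'n rvec \<Rightarrow> ('n + 'n) set set set" where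
  "Eeps M Q q = {{B, B'} | B B'. B \<in> Veps M Q q \<and> B' \<in> Veps M Q q \<and> B \<noteq> B' \<and>
     (\<exists>\<delta>>0. \<forall>\<epsilon>. 0 < \<epsilon> \<and> \<epsilon> < \<delta> \<longrightarrow>
       aff_dim (compl_cone M B \<inter> compl_cone M B' \<inter> Seps Q q \<epsilon>) = int CARD('d) - 1)}"

definition Vfull :: "('n::{finite,linorder}, 'n) rmat \<Rightarrow> ('n, 'd::finite) rmat \<Rightarrow> 'n rvec \<Rightarrow> ('n + 'n) set set" where
  "Vfull M Q q = {B \<in> Veps M Q q. aff_dim (crit_dom M Q q B) = int CARD('d)}"

end

theory Submission
  imports Defs
begin

text \<open>Choose \<open>q0\<close> in the common facet of the two critical domains such that every complementary cone
  containing \<open>q0\<close> meets that facet in full dimension \<open>d - 1\<close>. For small \<open>\<epsilon>\<close> the perturbed affine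
  space is transversal to all spans of columns, so points near \<open>q0\<close> interior to the two cones can be
  joined inside it by a segment that avoids all spans of at most \<open>n - 2\<close> columns. Where this segment
  leaves a complementary cone, it does so through the relative interior of a facet, and sufficiency
  provides a diagonal or exchange pivot to a cone on the other side; hence the traversed cones form a
  path. They all contain \<open>q0\<close>. Since the dimensions involved are eventually constant as \<open>\<epsilon>\<close> tends
  to \<open>0\<close>, one sufficiently small \<open>\<epsilon>\<close> decides membership in the perturbed graph.\<close>

section \<open>Complementary bases of a sufficient matrix\<close>

text \<open>A cone in V^eps may have a critical domain of dimension below d at \<epsilon> = 0; what
  survives the limit is incidence with \<open>q0\<close>: the cones are closed and finitely many, so
  one that meets a small ball around \<open>q0\<close> contains \<open>q0\<close>. Spans of n - 2
  columns are avoided for two reasons: where the segment leaves a cone only one coordinate may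
  vanish, and the ratio test of the exchange pivot must have no ties. Cycling never arises: instead
  of bounding a sequence of pivots, the proof takes the farthest point of the segment covered by
  cones reachable from \<open>B1\<close> and pivots beyond it. Sufficiency enters through the kernel
  and the row space of [I, -M], whose sign conditions treat complementary columns alike; so it
  applies at every basis without first proving that pivoting preserves it.\<close>

lemma compl_idx_simps [simp]:
  "compl_idx (Inl i) = Inr i" "compl_idx (Inr i) = Inl i"
  "compl_idx (compl_idx j) = j" "compl_idx j \<noteq> j" "j \<noteq> compl_idx j"
  "compl_idx j = compl_idx k \<longleftrightarrow> j = k"
  by (auto simp: compl_idx_def split: sum.splits)

lemma sum_Acol:
  "(\<Sum>j\<in>UNIV. x j *\<^sub>R Acol M j) = (\<chi> i. x (Inl i)) - M *v (\<chi> i. x (Inr i))"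
proof -
  have "(\<Sum>j\<in>UNIV. x j *\<^sub>R Acol M j)
      = (\<Sum>i\<in>UNIV. x (Inl i) *\<^sub>R axis i 1) + (\<Sum>i\<in>UNIV. x (Inr i) *\<^sub>R - column i M)"
    unfolding UNIV_sum
    by (subst sum.union_disjoint) (auto simp: Acol_def sum.reindex inj_on_def)
  also have "(\<Sum>i\<in>UNIV. x (Inl i) *\<^sub>R axis i 1) = (\<chi> i. x (Inl i))"
    by (simp add: vec_eq_iff axis_def if_distrib cong: if_cong)
  also have "(\<Sum>i\<in>UNIV. x (Inr i) *\<^sub>R - column i M) = - (M *v (\<chi> i. x (Inr i)))"
    by (simp add: vec_eq_iff matrix_vector_mult_def column_def sum_negf mult.commute)
  finally show ?thesis by simp
qed

text \<open>Kernel vectors of [I, -M] are the pairs (M z, z), so the product over a complementary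
  pair is z_i (M z)_i.\<close>

lemma column_sufficient_kernel:
  assumes "column_sufficient M" "(\<Sum>j\<in>UNIV. x j *\<^sub>R Acol M j) = 0"
    and "\<And>j. x j * x (compl_idx j) \<le> 0"
  shows "x j * x (compl_idx j) = 0"
proof -
  define z :: "real^'a" where "z = (\<chi> i. x (Inr i))"
  have Mz: "(M *v z) $ i = x (Inl i)" for i
    using assms(2) by (simp add: sum_Acol z_def vec_eq_iff)
  have "z $ i * (M *v z) $ i \<le> 0" for i
    using assms(3)[of "Inr i"] by (simp add: Mz) (simp add: z_def)
  then have "\<forall>i. z $ i * (M *v z) $ i = 0"
    using assms(1) unfolding column_sufficient_def by blast
  then have "x (Inr i) * x (Inl i) = 0" for i
    by (simp add: Mz) (simp add: z_def)
  then show ?thesis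
    by (cases j) (auto simp: mult.commute)
qed

lemma inner_Acol:
  "y \<bullet> Acol M (Inl i) = y $ i" "y \<bullet> Acol M (Inr i) = - (transpose M *v y) $ i"
  by (simp_all add: Acol_def inner_axis)
    (simp add: inner_vec_def vector_matrix_mult_def column_def mult.commute)

text \<open>Row space vectors of [I, -M] are the pairs (y, -M^T y); the minus sign reverses the
  inequality of the definition.\<close>

lemma row_sufficient_rowspace:
  assumes "row_sufficient M" "\<And>j. 0 \<le> (y \<bullet> Acol M j) * (y \<bullet> Acol M (compl_idx j))"
  shows "(y \<bullet> Acol M j) * (y \<bullet> Acol M (compl_idx j)) = 0"
proof -
  have "y $ i * (transpose M *v y) $ i \<le> 0" for i
    using assms(2)[of "Inl i"] by (simp add: inner_Acol)
  then have "\<forall>i. y $ i * (transpose M *v y) $ i = 0"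
    using assms(1) unfolding row_sufficient_def column_sufficient_def by blast
  then show ?thesis
    by (cases j) (auto simp: inner_Acol)
qed

section \<open>Coordinates with respect to a complementary basis\<close>

lemma complementary_full:
  fixes B :: "('n::finite + 'n) set"
  assumes "complementary B" "card B = CARD('n)"
  shows "compl_idx j \<in> B \<longleftrightarrow> j \<notin> B"
proof -
  \<comment> \<open>\<open>f\<close> forgets which column of a pair is meant; complementarity makes
    it injective on \<open>B\<close>, and counting makes it onto.\<close>
  define f :: "'n + 'n \<Rightarrow> 'n" where "f = case_sum id id"
  have f: "f j = f k \<Longrightarrow> j = k \<or> j = compl_idx k" for j k
    by (auto simp: f_def compl_idx_def split: sum.splits)
  have "inj_on f B"
    using assms(1) f by (fastforce simp: inj_on_def complementary_def)
  then have "card (f ` B) = CARD('n)"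
    using assms(2) by (simp add: card_image)
  then have "f ` B = UNIV"
    by (simp add: card_eq_UNIV_imp_eq_UNIV)
  then obtain k where "k \<in> B" "f j = f k"
    by (metis UNIV_I image_iff)
  then show ?thesis
    using f[of j k] assms(1) by (auto simp: complementary_def)
qed

text \<open>The \<open>y k\<close> are the rows of the inverse of A_B, and
  \<open>y k \<bullet> x\<close> is the \<open>k\<close>-th coordinate of \<open>x\<close>. The
  conjuncts say that both products with A_B are the identity; vectors indexed by \<open>B\<close>
  avoid numbering its columns.\<close>

definition dual_family :: "('n::finite, 'n) rmat \<Rightarrow> ('n + 'n) set \<Rightarrow> ('n + 'n \<Rightarrow> 'n rvec) \<Rightarrow> bool" where
  "dual_family M B y \<longleftrightarrow>
     (\<forall>k\<in>B. \<forall>l\<in>B. y k \<bullet> Acol M l = (if k = l then 1 else 0)) \<and>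
     (\<forall>x. x = (\<Sum>k\<in>B. (y k \<bullet> x) *\<^sub>R Acol M k))"

lemma compl_basis_dual_family:
  fixes M :: "('n::finite, 'n) rmat"
  assumes "compl_basis M B"
  obtains y where "dual_family M B y"
proof -
  let ?A = "Acol M"
  have inj: "inj_on ?A B" and ind: "independent (?A ` B)" and card: "card (?A ` B) = CARD('n)"
    using assms by (auto simp: compl_basis_def card_image)
  have sp: "span (?A ` B) = UNIV"
    using card_ge_dim_independent[of "?A ` B" UNIV] ind card by (auto simp: dim_UNIV)
  have "\<exists>v. \<forall>l\<in>B. v \<bullet> ?A l = (if k = l then 1 else 0)" if "k \<in> B" for k
  proof -
    obtain f where f: "linear f" "\<forall>x\<in>?A ` B. f x = (if x = ?A k then 1 else (0::real))"
      using linear_independent_extend[OF ind, of "\<lambda>x. if x = ?A k then 1 else 0"] by blast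
    define v where "v = (\<Sum>b\<in>Basis. f b *\<^sub>R b)"
    have v: "v \<bullet> x = f x" for x
    proof -
      have "f x = f (\<Sum>b\<in>Basis. (x \<bullet> b) *\<^sub>R b)" by (simp add: euclidean_representation)
      also have "\<dots> = (\<Sum>b\<in>Basis. f b *\<^sub>R b) \<bullet> x"
        using f(1) by (simp add: linear_sum linear_cmul inner_sum_left inner_commute[of x] mult.commute)
      finally show ?thesis by (simp add: v_def)
    qed
    then show ?thesis
      using f(2) inj that by (intro exI[of _ v]) (auto simp: inj_on_def v)
  qed
  then obtain y where y: "\<And>k l. k \<in> B \<Longrightarrow> l \<in> B \<Longrightarrow> y k \<bullet> ?A l = (if k = l then 1 else 0)"
    by metis
  have "x = (\<Sum>k\<in>B. (y k \<bullet> x) *\<^sub>R ?A k)" for x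
  proof -
    have "x \<in> span (?A ` B)" by (simp add: sp)
    then obtain c where "x = (\<Sum>v\<in>?A ` B. c v *\<^sub>R v)"
      by (auto simp: span_finite)
    then have c: "x = (\<Sum>l\<in>B. c (?A l) *\<^sub>R ?A l)"
      by (simp add: sum.reindex inj)
    have "y k \<bullet> x = c (?A k)" if "k \<in> B" for k
      using that by (subst c) (simp add: inner_sum_right y if_distrib cong: if_cong)
    then show ?thesis
      using c by simp
  qed
  with y show ?thesis
    by (intro that[of y]) (auto simp: dual_family_def)
qed

lemma dual_family_expand: "dual_family M B y \<Longrightarrow> (\<Sum>k\<in>B. (y k \<bullet> x) *\<^sub>R Acol M k) = x"
  unfolding dual_family_def by metis

lemma dual_family_inner:
  "dual_family M B y \<Longrightarrow> k \<in> B \<Longrightarrow> l \<in> B \<Longrightarrow> y k \<bullet> Acol M l = (if k = l then 1 else 0)"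
  unfolding dual_family_def by metis

lemma dual_family_sum_right:
  assumes "dual_family M B y" "k \<in> B"
  shows "y k \<bullet> (\<Sum>l\<in>B. c l *\<^sub>R Acol M l) = c k"
proof -
  have "y k \<bullet> (\<Sum>l\<in>B. c l *\<^sub>R Acol M l) = (\<Sum>l\<in>B. if k = l then c l else 0)"
    unfolding inner_sum_right
    by (rule sum.cong) (use assms in \<open>simp_all add: dual_family_inner[OF assms(1)]\<close>)
  then show ?thesis using assms(2) by simp
qed

lemma dual_family_sum_left:
  assumes "dual_family M B y" "k \<in> B"
  shows "(\<Sum>l\<in>B. c l *\<^sub>R y l) \<bullet> Acol M k = c k"
proof -
  have "(\<Sum>l\<in>B. c l *\<^sub>R y l) \<bullet> Acol M k = (\<Sum>l\<in>B. if l = k then c l else 0)"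
    unfolding inner_sum_left
    by (rule sum.cong) (use assms in \<open>simp_all add: dual_family_inner[OF assms(1)]\<close>)
  then show ?thesis using assms(2) by simp
qed

definition polycone :: "'n rvec set \<Rightarrow> 'n::finite rvec set" where
  "polycone N = {x. \<forall>a\<in>N. 0 \<le> a \<bullet> x}"

text \<open>Coordinates are unique, so nonnegative coefficients amount to nonnegative dual
  coordinates. In this form cones can be intersected by collecting normals.\<close>

lemma compl_cone_eq_polycone:
  assumes "dual_family M B y"
  shows "compl_cone M B = polycone (y ` B)"
proof (intro equalityI subsetI)
  fix x assume "x \<in> compl_cone M B"
  then obtain c where c: "x = (\<Sum>j\<in>B. c j *\<^sub>R Acol M j)" "\<forall>j\<in>B. c j \<ge> 0"
    by (auto simp: compl_cone_def)
  have "y k \<bullet> x = c k" if "k \<in> B" for k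
    unfolding c(1) by (rule dual_family_sum_right[OF assms that])
  then show "x \<in> polycone (y ` B)"
    using c(2) by (simp add: polycone_def)
next
  fix x assume "x \<in> polycone (y ` B)"
  moreover have "x = (\<Sum>k\<in>B. (y k \<bullet> x) *\<^sub>R Acol M k)"
    using dual_family_expand[OF assms] by metis
  ultimately show "x \<in> compl_cone M B"
    unfolding compl_cone_def polycone_def by auto
qed

text \<open>Column sufficiency makes the union of the supports of two solutions of the same
  linear complementarity problem complementary.\<close>

lemma compl_cone_interior_unique:
  assumes "column_sufficient M" "compl_basis M B" "compl_basis M B'" "dual_family M B y"
    and x: "\<And>k. k \<in> B \<Longrightarrow> 0 < y k \<bullet> x" and "x \<in> compl_cone M B'"
  shows "B' = B"
proof -
  have full: "compl_idx j \<in> B \<longleftrightarrow> j \<notin> B" "compl_idx j \<in> B' \<longleftrightarrow> j \<notin> B'" for j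
    using assms(2,3) complementary_full unfolding compl_basis_def by blast+
  obtain c where c: "x = (\<Sum>j\<in>B'. c j *\<^sub>R Acol M j)" "\<forall>j\<in>B'. c j \<ge> 0"
    using assms(6) by (auto simp: compl_cone_def)
  define u where "u j = (if j \<in> B then y j \<bullet> x else 0)" for j
  define v where "v j = (if j \<in> B' then c j else 0)" for j
  have "(\<Sum>j\<in>UNIV. u j *\<^sub>R Acol M j) = (\<Sum>j\<in>B. (y j \<bullet> x) *\<^sub>R Acol M j)"
    by (rule sum.mono_neutral_cong_right) (auto simp: u_def)
  also have "\<dots> = x" by (rule dual_family_expand[OF assms(4)])
  finally have su: "(\<Sum>j\<in>UNIV. u j *\<^sub>R Acol M j) = x" .
  have sv: "(\<Sum>j\<in>UNIV. v j *\<^sub>R Acol M j) = x"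
    unfolding c(1) by (rule sum.mono_neutral_cong_right) (auto simp: v_def)
  have u0: "0 \<le> u j" "u j * u (compl_idx j) = 0" for j
    using x full by (auto simp: u_def less_imp_le)
  have v0: "0 \<le> v j" "v j * v (compl_idx j) = 0" for j
    using c(2) full by (auto simp: v_def)
  \<comment> \<open>Both solutions are complementary, so the pure products vanish and two
    nonpositive mixed terms remain; column sufficiency makes each of them zero.\<close>
  have eq: "(u j - v j) * (u (compl_idx j) - v (compl_idx j))
      = - (u j * v (compl_idx j)) - v j * u (compl_idx j)" for j
    using u0(2)[of j] v0(2)[of j] by (auto simp: algebra_simps)
  have uv0: "(u j - v j) * (u (compl_idx j) - v (compl_idx j)) = 0" for j
  proof (rule column_sufficient_kernel[OF assms(1)])
    show "(\<Sum>j\<in>UNIV. (u j - v j) *\<^sub>R Acol M j) = 0"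
      using su sv by (simp add: scaleR_diff_left sum_subtractf)
    show "(u j - v j) * (u (compl_idx j) - v (compl_idx j)) \<le> 0" for j
      unfolding eq using mult_nonneg_nonneg[OF u0(1)[of j] v0(1)[of "compl_idx j"]]
        mult_nonneg_nonneg[OF v0(1)[of j] u0(1)[of "compl_idx j"]] by linarith
  qed
  have uv: "u j * v (compl_idx j) = 0" for j
    using eq[of j] uv0[of j] mult_nonneg_nonneg[OF u0(1)[of j] v0(1)[of "compl_idx j"]]
      mult_nonneg_nonneg[OF v0(1)[of j] u0(1)[of "compl_idx j"]] by linarith
  \<comment> \<open>\<open>u\<close> is positive on all of \<open>B\<close>, so \<open>v\<close>
    vanishes off \<open>B\<close> and hence consists of the same positive coordinates.\<close>
  have vB: "v j = 0" if "j \<notin> B" for j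
  proof -
    have "0 < u (compl_idx j)" using that full x by (auto simp: u_def)
    then show ?thesis using uv[of "compl_idx j"] by simp
  qed
  have "x = (\<Sum>j\<in>B. v j *\<^sub>R Acol M j)"
    unfolding sv[symmetric] by (rule sum.mono_neutral_cong_right) (auto simp: vB)
  then have "y k \<bullet> x = v k" if "k \<in> B" for k
    using dual_family_sum_right[OF assms(4) that, of v] by simp
  then have "v k > 0" if "k \<in> B" for k using x that by simp
  then have "B \<subseteq> B'" by (metis less_irrefl subsetI v_def)
  then show ?thesis
    using assms(2,3) by (metis card_subset_eq compl_basis_def finite)
qed

text \<open>Let N be the inverse of A_B times the matrix of complementary columns, so that
  \<open>y k \<bullet> v\<close> is (N \<zeta>)_k. The entries -(N \<zeta>) on \<open>B\<close> and
  \<zeta> on the complement form a kernel vector of [I, -M]. In effect the principal pivot transform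
  -N is column sufficient.\<close>

lemma column_sufficient_dual_family:
  assumes "column_sufficient M" "compl_basis M B" "dual_family M B y"
    and v: "v = (\<Sum>l\<in>B. \<zeta> l *\<^sub>R Acol M (compl_idx l))"
    and nn: "\<And>k. k \<in> B \<Longrightarrow> 0 \<le> \<zeta> k * (y k \<bullet> v)" and "k \<in> B"
  shows "\<zeta> k * (y k \<bullet> v) = 0"
proof -
  have full: "compl_idx j \<in> B \<longleftrightarrow> j \<notin> B" for j
    using assms(2) complementary_full unfolding compl_basis_def by blast
  define x where "x j = (if j \<in> B then - (y j \<bullet> v) else \<zeta> (compl_idx j))" for j
  have U: "UNIV = B \<union> compl_idx ` B" "B \<inter> compl_idx ` B = {}"
  proof -
    have "j \<in> compl_idx ` B" if "j \<notin> B" for j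
      using that full by (intro image_eqI[of _ _ "compl_idx j"]) auto
    then show "UNIV = B \<union> compl_idx ` B" by auto
  qed (use full in auto)
  have "(\<Sum>j\<in>UNIV. x j *\<^sub>R Acol M j)
      = (\<Sum>j\<in>B. x j *\<^sub>R Acol M j) + (\<Sum>j\<in>compl_idx ` B. x j *\<^sub>R Acol M j)"
    unfolding U(1) by (rule sum.union_disjoint) (use U(2) in auto)
  also have "(\<Sum>j\<in>compl_idx ` B. x j *\<^sub>R Acol M j) = v"
    unfolding v by (subst sum.reindex) (use full in \<open>auto simp: inj_on_def x_def intro!: sum.cong\<close>)
  also have "(\<Sum>j\<in>B. x j *\<^sub>R Acol M j) = - (\<Sum>j\<in>B. (y j \<bullet> v) *\<^sub>R Acol M j)"
    by (simp add: x_def sum_negf[symmetric])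
  also have "\<dots> = - v" by (simp add: dual_family_expand[OF assms(3)])
  finally have sum0: "(\<Sum>j\<in>UNIV. x j *\<^sub>R Acol M j) = 0" by simp
  have "x j * x (compl_idx j) \<le> 0" for j
    using nn[of j] nn[of "compl_idx j"] full[of j] by (auto simp: x_def mult.commute)
  from column_sufficient_kernel[OF assms(1) sum0 this, of k] show ?thesis
    using \<open>k \<in> B\<close> full[of k] by (auto simp: x_def)
qed

text \<open>The inner products of \<open>u\<close> are \<eta> with the columns in \<open>B\<close>
  and N^T \<eta> with the complementary ones, N as in \<open>column_sufficient_dual_family\<close>;
  so this is row sufficiency of -N.\<close>

lemma row_sufficient_dual_family:
  assumes "row_sufficient M" "compl_basis M B" "dual_family M B y"
    and u: "u = (\<Sum>l\<in>B. \<eta> l *\<^sub>R y l)"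
    and nn: "\<And>k. k \<in> B \<Longrightarrow> 0 \<le> \<eta> k * (u \<bullet> Acol M (compl_idx k))" and "k \<in> B"
  shows "\<eta> k * (u \<bullet> Acol M (compl_idx k)) = 0"
proof -
  have full: "compl_idx j \<in> B \<longleftrightarrow> j \<notin> B" for j
    using assms(2) complementary_full unfolding compl_basis_def by blast
  have uA: "u \<bullet> Acol M j = \<eta> j" if "j \<in> B" for j
    unfolding u by (rule dual_family_sum_left[OF assms(3) that])
  have "0 \<le> (u \<bullet> Acol M j) * (u \<bullet> Acol M (compl_idx j))" for j
    using nn[of j] nn[of "compl_idx j"] full[of j] by (auto simp: uA mult.commute)
  from row_sufficient_rowspace[OF assms(1) this, of k] show ?thesis
    using \<open>k \<in> B\<close> by (simp add: uA)
qed

text \<open>Test row sufficiency with a unit vector: a positive entry would be a nonzero product of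
  the admissible sign.\<close>

lemma dual_family_diagonal_le:
  assumes "row_sufficient M" "compl_basis M B" "dual_family M B y" "j \<in> B"
  shows "y j \<bullet> Acol M (compl_idx j) \<le> 0"
proof (rule ccontr)
  assume "\<not> ?thesis"
  moreover have "(if j = j then 1 else 0) * (y j \<bullet> Acol M (compl_idx j)) = 0"
    by (rule row_sufficient_dual_family[where \<eta> = "\<lambda>l. if l = j then 1 else 0", OF assms(1-3)])
      (use assms(4) calculation in \<open>auto simp: if_distrib[of "\<lambda>c. c *\<^sub>R _"] cong: if_cong\<close>)
  ultimately show False by simp
qed

text \<open>The two numbers are the negated \<open>(k, j)\<close> and \<open>(j, k)\<close> entries of the principal pivot transform
  of \<open>M\<close> with respect to \<open>B\<close>; column sufficiency gives one direction, row sufficiency the other.\<close>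

lemma dual_family_exchange_sign:
  assumes "sufficient M" "compl_basis M B" "dual_family M B y" "j \<in> B" "k \<in> B" "k \<noteq> j"
    and diag: "y j \<bullet> Acol M (compl_idx j) = 0"
  shows "0 < y k \<bullet> Acol M (compl_idx j) \<longleftrightarrow> y j \<bullet> Acol M (compl_idx k) < 0"
proof -
  define a b e where "a = y k \<bullet> Acol M (compl_idx j)" and "b = y j \<bullet> Acol M (compl_idx k)"
    and "e = y k \<bullet> Acol M (compl_idx k)"
  have cs: "column_sufficient M" and rs: "row_sufficient M"
    using assms(1) by (auto simp: sufficient_def)
  have two: "(\<Sum>l\<in>B. (if l = j then s else if l = k then t else 0) *\<^sub>R f l) = s *\<^sub>R f j + t *\<^sub>R f k"
    for s t and f :: "_ \<Rightarrow> (real, 'a) vec"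
  proof -
    have "(\<Sum>l\<in>B. (if l = j then s else if l = k then t else 0) *\<^sub>R f l)
        = (\<Sum>l\<in>{j, k}. (if l = j then s else if l = k then t else 0) *\<^sub>R f l)"
      by (rule sum.mono_neutral_right) (use assms(4,5) in auto)
    then show ?thesis using assms(6) by auto
  qed
  have "b < 0" if "0 < a"
  proof (rule ccontr)
    assume "\<not> b < 0"
    \<comment> \<open>\<open>s\<close> is large enough to outweigh the diagonal entry
      \<open>e\<close>: by \<open>diag\<close> the product at \<open>j\<close> is a nonnegative
      multiple of \<open>b\<close>, and the one at \<open>k\<close> is at least 1.\<close>
    define s where "s = (\<bar>e\<bar> + 1) / a"
    have s: "0 < s" "s * a = \<bar>e\<bar> + 1" using that by (auto simp: s_def)
    define \<zeta> where "\<zeta> l = (if l = j then s else if l = k then 1 else 0)" for l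
    define v where "v = s *\<^sub>R Acol M (compl_idx j) + 1 *\<^sub>R Acol M (compl_idx k)"
    have v: "v = (\<Sum>l\<in>B. \<zeta> l *\<^sub>R Acol M (compl_idx l))"
      unfolding v_def \<zeta>_def by (rule two[symmetric])
    have yv: "y j \<bullet> v = b" "y k \<bullet> v = s * a + e"
      using diag by (auto simp: v_def inner_add_right a_def b_def e_def)
    have "\<zeta> k * (y k \<bullet> v) = 0"
      by (rule column_sufficient_dual_family[OF cs assms(2,3) v _ assms(5)])
        (use s \<open>\<not> b < 0\<close> yv assms(6) in \<open>auto simp: \<zeta>_def\<close>)
    then show False
      using yv s assms(6) by (simp add: \<zeta>_def)
  qed
  moreover have "0 < a" if "b < 0"
  proof (rule ccontr)
    assume "\<not> 0 < a"
    \<comment> \<open>The same device in the row space, now with coefficient -1 at \<open>k\<close>: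
      the products are \<open>- s * a\<close> at \<open>j\<close> and \<open>e - s * b\<close> at
      \<open>k\<close>, the latter at least 1.\<close>
    define s where "s = (\<bar>e\<bar> + 1) / - b"
    have s: "0 < s" "s * b = - \<bar>e\<bar> - 1" using that by (auto simp: s_def field_simps)
    define \<eta> where "\<eta> l = (if l = j then s else if l = k then -1 else 0)" for l
    define u where "u = s *\<^sub>R y j + (-1) *\<^sub>R y k"
    have u: "u = (\<Sum>l\<in>B. \<eta> l *\<^sub>R y l)"
      unfolding u_def \<eta>_def by (rule two[symmetric])
    have uA: "u \<bullet> Acol M (compl_idx j) = - a" "u \<bullet> Acol M (compl_idx k) = s * b - e"
      using diag by (auto simp: u_def inner_diff_left a_def b_def e_def)
    have "\<eta> k * (u \<bullet> Acol M (compl_idx k)) = 0"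
      by (rule row_sufficient_dual_family[OF rs assms(2,3) u _ assms(5)])
        (use s \<open>\<not> 0 < a\<close> uA assms(6) in \<open>auto simp: \<eta>_def mult_nonneg_nonpos\<close>)
    then show False
      using uA s assms(6) by (simp add: \<eta>_def)
  qed
  ultimately show ?thesis
    unfolding a_def b_def by blast
qed

section \<open>Pivots and the crossing of a facet\<close>

lemma compl_basis_if_expansion:
  fixes B :: "('n::finite + 'n) set"
  assumes "complementary B" "card B = CARD('n)"
    and exp: "\<And>x. (\<Sum>k\<in>B. (w k \<bullet> x) *\<^sub>R Acol M k) = x"
  shows "compl_basis M B" "dual_family M B w"
proof -
  have "x \<in> span (Acol M ` B)" for x
    by (subst exp[symmetric]) (intro span_sum span_scale span_base imageI)
  \<comment> \<open>n spanning vectors of R^n are independent; uniqueness of coordinates then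
    identifies \<open>w\<close> with the dual family on \<open>B\<close>.\<close>
  then have sp: "UNIV \<subseteq> span (Acol M ` B)" by blast
  have "card (Acol M ` B) \<le> CARD('n)"
    using card_image_le[of B "Acol M"] assms(2) by simp
  moreover from this have ind: "independent (Acol M ` B)"
    using card_le_dim_spanning[of "Acol M ` B" UNIV, OF _ sp] by simp
  moreover have "CARD('n) \<le> card (Acol M ` B)"
    using dim_le_card[OF sp] by simp
  ultimately have "inj_on (Acol M) B"
    using assms(2) by (intro eq_card_imp_inj_on) auto
  then show cb: "compl_basis M B"
    using assms(1,2) ind by (simp add: compl_basis_def)
  obtain y where y: "dual_family M B y"
    using compl_basis_dual_family[OF cb] .
  have "y k \<bullet> x = w k \<bullet> x" if "k \<in> B" for k x
    using dual_family_sum_right[OF y that, of "\<lambda>l. w l \<bullet> x"] by (simp add: exp)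
  then have "\<And>k. k \<in> B \<Longrightarrow> y k = w k"
    by (metis vector_eq_rdot)
  then show "dual_family M B w"
    using y by (simp add: dual_family_def)
qed

text \<open>The row operation of a Gauss-Jordan pivot on \<open>w k \<bullet> Acol M m\<close>. It
  is stated for expansions because the exchange pivot passes through a set containing both
  \<open>j\<close> and \<open>compl_idx j\<close>, which is not complementary.\<close>

lemma expansion_exchange:
  fixes B :: "('n::finite + 'n) set"
  assumes exp: "\<And>x. (\<Sum>k\<in>B. (w k \<bullet> x) *\<^sub>R Acol M k) = x"
    and "k \<in> B" "m \<notin> B" "w k \<bullet> Acol M m \<noteq> 0"
    and w': "w' = (\<lambda>l. if l = m then (1 / (w k \<bullet> Acol M m)) *\<^sub>R w k
                     else w l - ((w l \<bullet> Acol M m) / (w k \<bullet> Acol M m)) *\<^sub>R w k)"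
  shows "(\<Sum>l\<in>insert m (B - {k}). (w' l \<bullet> x) *\<^sub>R Acol M l) = x"
proof -
  define t where "t = (w k \<bullet> x) / (w k \<bullet> Acol M m)"
  have sum1: "(\<Sum>l\<in>B - {k}. (w l \<bullet> z) *\<^sub>R Acol M l) = z - (w k \<bullet> z) *\<^sub>R Acol M k" for z
    using exp[of z] sum.remove[OF _ \<open>k \<in> B\<close>, of "\<lambda>l. (w l \<bullet> z) *\<^sub>R Acol M l"] by (simp add: algebra_simps)
  have "(\<Sum>l\<in>B - {k}. (w' l \<bullet> x) *\<^sub>R Acol M l)
      = (\<Sum>l\<in>B - {k}. (w l \<bullet> x) *\<^sub>R Acol M l - t *\<^sub>R ((w l \<bullet> Acol M m) *\<^sub>R Acol M l))"
    by (rule sum.cong) (use assms(3) in \<open>auto simp: w' t_def inner_diff_left algebra_simps\<close>)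
  also have "\<dots> = x - (w k \<bullet> x) *\<^sub>R Acol M k - t *\<^sub>R (Acol M m - (w k \<bullet> Acol M m) *\<^sub>R Acol M k)"
    by (simp only: sum_subtractf scaleR_sum_right[symmetric] sum1)
  also have "\<dots> = x - t *\<^sub>R Acol M m"
    using assms(4) by (simp add: t_def scaleR_diff_right)
  finally have "(\<Sum>l\<in>B - {k}. (w' l \<bullet> x) *\<^sub>R Acol M l) = x - t *\<^sub>R Acol M m" .
  moreover have "w' m \<bullet> x = t" by (simp add: w' t_def)
  ultimately show ?thesis
    using assms(3) by (subst sum.insert) auto
qed

lemma ball_inner_pos:
  fixes p :: "'a::euclidean_space"
  assumes "finite K" "\<And>k. k \<in> K \<Longrightarrow> 0 < w k \<bullet> p"
  obtains r where "0 < r" "\<And>x k. x \<in> ball p r \<Longrightarrow> k \<in> K \<Longrightarrow> 0 < w k \<bullet> x"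
proof -
  have "open (\<Inter>k\<in>K. {x. 0 < w k \<bullet> x})"
    using assms(1) open_halfspace_gt[of 0] by (intro open_INT) auto
  moreover have "p \<in> (\<Inter>k\<in>K. {x. 0 < w k \<bullet> x})"
    using assms(2) by auto
  ultimately obtain r where "0 < r" "ball p r \<subseteq> (\<Inter>k\<in>K. {x. 0 < w k \<bullet> x})"
    by (meson open_contains_ball)
  then show ?thesis by (intro that[of r]) auto
qed

text \<open>The common end of both pivots. The coordinate of the new column \<open>m\<close> is
  \<open>v\<close> divided by a negative number, so the new cone lies beyond the hyperplane of
  \<open>v\<close>; the other coordinates are positive at \<open>p\<close>, so near \<open>p\<close>
  no other constraint is active.\<close>

lemma crossing_cone:
  fixes B :: "('n::finite + 'n) set"
  assumes B: "complementary B" "card B = CARD('n)"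
    and exp: "\<And>x. (\<Sum>k\<in>B. (w k \<bullet> x) *\<^sub>R Acol M k) = x"
    and "m \<in> B" "w m = (1 / b) *\<^sub>R v" "b < 0"
    and pos: "\<And>k. k \<in> B \<Longrightarrow> k \<noteq> m \<Longrightarrow> 0 < w k \<bullet> p"
  obtains r where "compl_basis M B" "0 < r"
    "\<And>x. x \<in> ball p r \<Longrightarrow> v \<bullet> x \<le> 0 \<Longrightarrow> x \<in> compl_cone M B"
    "\<And>x. x \<in> compl_cone M B \<Longrightarrow> v \<bullet> x \<le> 0"
proof -
  have cb: "compl_basis M B" and df: "dual_family M B w"
    using compl_basis_if_expansion[OF B exp] by auto
  have C: "compl_cone M B = polycone (w ` B)"
    by (rule compl_cone_eq_polycone[OF df])
  obtain r where r: "0 < r" "\<And>x k. x \<in> ball p r \<Longrightarrow> k \<in> B - {m} \<Longrightarrow> 0 < w k \<bullet> x"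
    using ball_inner_pos[of "B - {m}" w p] pos by auto
  have wm: "0 \<le> w m \<bullet> x \<longleftrightarrow> v \<bullet> x \<le> 0" for x
    using assms(5,6) by (simp add: zero_le_divide_iff)
  show ?thesis
  proof (rule that[OF cb r(1)])
    fix x assume "x \<in> ball p r" "v \<bullet> x \<le> 0"
    then have "0 \<le> w k \<bullet> x" if "k \<in> B" for k
      using r(2)[of x k] wm[of x] that by (cases "k = m") auto
    then show "x \<in> compl_cone M B"
      by (auto simp: C polycone_def)
  next
    fix x assume "x \<in> compl_cone M B"
    then show "v \<bullet> x \<le> 0"
      using wm[of x] \<open>m \<in> B\<close> by (auto simp: C polycone_def)
  qed
qed

text \<open>If neither a diagonal nor an exchange pivot were possible, the facet would support the cone of
  all feasible right-hand sides, contradicting the existence of \<open>z\<close>.\<close>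

lemma adjacent_compl_cone:
  fixes M :: "('n::finite, 'n) rmat"
  assumes "sufficient M" "compl_basis M B" "dual_family M B y" "j \<in> B"
    and pj: "y j \<bullet> p = 0" and pos: "\<And>k. k \<in> B \<Longrightarrow> k \<noteq> j \<Longrightarrow> 0 < y k \<bullet> p"
    and gen: "\<And>J. card J + 2 \<le> CARD('n) \<Longrightarrow> p \<notin> span (Acol M ` J)"
    and feas: "z \<in> compl_cone M B2" "y j \<bullet> z < 0"
  obtains B' r where "compl_basis M B'" "0 < r"
    "\<And>x. x \<in> ball p r \<Longrightarrow> y j \<bullet> x \<le> 0 \<Longrightarrow> x \<in> compl_cone M B'"
    "\<And>x. x \<in> compl_cone M B' \<Longrightarrow> y j \<bullet> x \<le> 0"
proof -
  have cB: "complementary B" and card: "card B = CARD('n)"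
    using assms(2) by (auto simp: compl_basis_def)
  have full: "compl_idx l \<in> B \<longleftrightarrow> l \<notin> B" for l
    using complementary_full[OF cB card] .
  note exp = dual_family_expand[OF assms(3)]
  have rs: "row_sufficient M" using assms(1) by (simp add: sufficient_def)
  define a where "a k = y k \<bullet> Acol M (compl_idx j)" for k
  have "a j \<le> 0"
    unfolding a_def by (rule dual_family_diagonal_le[OF rs assms(2-4)])
  then consider "a j < 0" | "a j = 0" by linarith
  then show ?thesis
  proof cases
    case 1
    \<comment> \<open>Diagonal pivot: \<open>y j \<bullet> p = 0\<close> keeps the other coordinates
      of \<open>p\<close>, and \<open>a j < 0\<close> reverses the facet normal.\<close>
    define w where "w = (\<lambda>l. if l = compl_idx j then (1 / a j) *\<^sub>R y j else y l - (a l / a j) *\<^sub>R y j)"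
    define B' where "B' = insert (compl_idx j) (B - {j})"
    have exp': "(\<Sum>l\<in>B'. (w l \<bullet> x) *\<^sub>R Acol M l) = x" for x
      unfolding B'_def
    proof (rule expansion_exchange[where w = y and k = j])
      show "w = (\<lambda>l. if l = compl_idx j then (1 / (y j \<bullet> Acol M (compl_idx j))) *\<^sub>R y j
        else y l - ((y l \<bullet> Acol M (compl_idx j)) / (y j \<bullet> Acol M (compl_idx j))) *\<^sub>R y j)"
        unfolding w_def a_def ..
    qed (use 1 full \<open>j \<in> B\<close> in \<open>simp_all add: exp a_def\<close>)
    have cB': "complementary B'"
      using full \<open>j \<in> B\<close> by (auto simp: complementary_def B'_def)
    have card': "card B' = CARD('n)"
      using card full \<open>j \<in> B\<close> by (simp add: B'_def)
    have pos': "0 < w k \<bullet> p" if "k \<in> B'" "k \<noteq> compl_idx j" for k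
      using that pos[of k] pj by (auto simp: w_def B'_def inner_diff_left)
    have m: "compl_idx j \<in> B'" "w (compl_idx j) = (1 / a j) *\<^sub>R y j"
      by (auto simp: w_def B'_def)
    show ?thesis
      by (rule crossing_cone[OF cB' card' exp' m 1], erule (1) pos', rule that)
  next
    case 2
    have sgn: "0 < a k \<longleftrightarrow> y j \<bullet> Acol M (compl_idx k) < 0" if "k \<in> B" "k \<noteq> j" for k
      using dual_family_exchange_sign[OF assms(1-4) that] 2 by (simp add: a_def)
    \<comment> \<open>The coordinates that decrease as column \<open>compl_idx j\<close> enters,
      hence the domain of the ratio test.\<close>
    define K where "K = {k \<in> B. k \<noteq> j \<and> 0 < a k}"
    have "K \<noteq> {}"
    proof
      assume "K = {}"
      have nn: "0 \<le> y j \<bullet> Acol M l" for l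
      proof (cases "l \<in> B")
        case True
        then show ?thesis
          using dual_family_inner[OF assms(3,4), of l] by simp
      next
        case False
        then have c: "compl_idx l \<in> B" by (simp add: full)
        show ?thesis
        proof (cases "compl_idx l = j")
          case True
          then have "l = compl_idx j" by auto
          then show ?thesis using 2 by (simp add: a_def)
        next
          case False
          then show ?thesis
            using sgn[OF c] \<open>K = {}\<close> c by (auto simp: K_def not_less)
        qed
      qed
      obtain c where c: "z = (\<Sum>j\<in>B2. c j *\<^sub>R Acol M j)" "\<forall>j\<in>B2. c j \<ge> 0"
        using feas(1) by (auto simp: compl_cone_def)
      have "0 \<le> y j \<bullet> z"
        unfolding c(1) inner_sum_right using c(2) nn by (auto intro!: sum_nonneg)
      then show False using feas(2) by simp
    qed
    moreover have "finite K" by simp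
    ultimately obtain k where k: "k \<in> K" and kmin: "\<And>l. l \<in> K \<Longrightarrow> y k \<bullet> p / a k \<le> y l \<bullet> p / a l"
      using ex_min_if_finite[of "(\<lambda>k. y k \<bullet> p / a k) ` K"] by (auto simp: not_less)
    have kB: "k \<in> B" "k \<noteq> j" "0 < a k" using k by (auto simp: K_def)
    \<comment> \<open>The coordinate of \<open>p\<close> on the entering column after the first
      pivot.\<close>
    define t where "t = y k \<bullet> p / a k"
    have ratio: "0 < y l \<bullet> p - a l * t" if l: "l \<in> B" "l \<noteq> j" "l \<noteq> k" for l
    proof (cases "0 < a l")
      case False
      moreover have "0 < t" using kB pos by (simp add: t_def)
      ultimately have "a l * t \<le> 0" by (simp add: mult_nonpos_nonneg)
      then show ?thesis using pos[OF l(1,2)] by simp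
    next
      case True
      then have "0 \<le> y l \<bullet> p - a l * t"
        using kmin[of l] l by (simp add: K_def t_def field_simps)
      \<comment> \<open>A tie would annihilate the coordinates \<open>j\<close>, \<open>k\<close>
        and \<open>l\<close> at once and leave \<open>p\<close> in the span of (n - 3) + 1 columns,
        against \<open>gen\<close>.\<close>
      moreover have "y l \<bullet> p - a l * t \<noteq> 0"
      proof
        assume l0: "y l \<bullet> p - a l * t = 0"
        let ?q = "p - t *\<^sub>R Acol M (compl_idx j)"
        have "?q = (\<Sum>m\<in>B. (y m \<bullet> ?q) *\<^sub>R Acol M m)"
          by (rule exp[symmetric])
        also have "\<dots> = (\<Sum>m\<in>B - {j, k, l}. (y m \<bullet> ?q) *\<^sub>R Acol M m)"
          by (rule sum.mono_neutral_right)
            (use pj 2 l0 kB in \<open>auto simp: inner_diff_right a_def[symmetric] t_def mult.commute\<close>)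
        also have "\<dots> \<in> span (Acol M ` insert (compl_idx j) (B - {j, k, l}))"
          by (intro span_sum span_scale span_base imageI) auto
        finally have "?q \<in> span (Acol M ` insert (compl_idx j) (B - {j, k, l}))" .
        moreover have "t *\<^sub>R Acol M (compl_idx j) \<in> span (Acol M ` insert (compl_idx j) (B - {j, k, l}))"
          by (intro span_scale span_base) auto
        ultimately have "?q + t *\<^sub>R Acol M (compl_idx j)
            \<in> span (Acol M ` insert (compl_idx j) (B - {j, k, l}))"
          by (rule span_add)
        moreover have "card (insert (compl_idx j) (B - {j, k, l})) + 2 \<le> CARD('n)"
        proof -
          have "card {j, k, l} = 3" using l kB by simp
          moreover have "card {j, k, l} \<le> card B"
            using l kB \<open>j \<in> B\<close> by (intro card_mono) auto
          moreover have "card (B - {j, k, l}) = card B - card {j, k, l}"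
            using l kB \<open>j \<in> B\<close> by (intro card_Diff_subset) auto
          moreover have "card (insert (compl_idx j) (B - {j, k, l})) \<le> Suc (card (B - {j, k, l}))"
            by (rule card_insert_le_m1) auto
          ultimately show ?thesis using card by linarith
        qed
        ultimately show False using gen by fastforce
      qed
      ultimately show ?thesis by simp
    qed
    define b where "b = y j \<bullet> Acol M (compl_idx k)"
    have b: "b < 0" using sgn[OF kB(1,2)] kB(3) by (simp add: b_def)
    \<comment> \<open>Two successive pivots: \<open>compl_idx j\<close> replaces \<open>k\<close>,
      then \<open>compl_idx k\<close> replaces \<open>j\<close>. As \<open>a j = 0\<close>, the
      first keeps the row \<open>y j\<close>, so the second divides it by \<open>b < 0\<close>; as
      \<open>y j \<bullet> p = 0\<close>, the second keeps the remaining coordinates of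
      \<open>p\<close>.\<close>
    define w1 where "w1 = (\<lambda>l. if l = compl_idx j then (1 / a k) *\<^sub>R y k else y l - (a l / a k) *\<^sub>R y k)"
    define w where "w = (\<lambda>l. if l = compl_idx k then (1 / b) *\<^sub>R y j
      else w1 l - ((w1 l \<bullet> Acol M (compl_idx k)) / b) *\<^sub>R y j)"
    define B1 where "B1 = insert (compl_idx j) (B - {k})"
    define B' where "B' = insert (compl_idx k) (B1 - {j})"
    have w1j: "w1 j = y j" using 2 by (simp add: w1_def)
    have exp1: "(\<Sum>l\<in>B1. (w1 l \<bullet> x) *\<^sub>R Acol M l) = x" for x
      unfolding B1_def
    proof (rule expansion_exchange[where w = y and k = k])
      show "w1 = (\<lambda>l. if l = compl_idx j then (1 / (y k \<bullet> Acol M (compl_idx j))) *\<^sub>R y k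
        else y l - ((y l \<bullet> Acol M (compl_idx j)) / (y k \<bullet> Acol M (compl_idx j))) *\<^sub>R y k)"
        unfolding w1_def a_def ..
    qed (use kB full \<open>j \<in> B\<close> in \<open>simp_all add: exp a_def\<close>)
    have B1: "j \<in> B1" "compl_idx k \<notin> B1"
      using kB full \<open>j \<in> B\<close> by (auto simp: B1_def)
    have exp': "(\<Sum>l\<in>B'. (w l \<bullet> x) *\<^sub>R Acol M l) = x" for x
      unfolding B'_def
    proof (rule expansion_exchange[where w = w1 and k = j])
      show "w = (\<lambda>l. if l = compl_idx k then (1 / (w1 j \<bullet> Acol M (compl_idx k))) *\<^sub>R w1 j
        else w1 l - ((w1 l \<bullet> Acol M (compl_idx k)) / (w1 j \<bullet> Acol M (compl_idx k))) *\<^sub>R w1 j)"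
        unfolding w_def w1j b_def ..
    qed (use b B1 in \<open>simp_all add: exp1 w1j b_def\<close>)
    have "compl_idx j \<noteq> k" "compl_idx k \<noteq> j"
      using full[of j] full[of k] \<open>j \<in> B\<close> kB(1) by auto
    then have cross: "compl_idx j \<noteq> k" "compl_idx k \<noteq> j" "k \<noteq> compl_idx j" "j \<noteq> compl_idx k"
      by auto
    have cB': "complementary B'"
      unfolding complementary_def
    proof
      fix l assume "l \<in> B'"
      then consider "l = compl_idx k" | "l = compl_idx j" | "l \<in> B" "l \<noteq> j" "l \<noteq> k"
        by (auto simp: B'_def B1_def)
      then show "compl_idx l \<notin> B'"
        by cases (use full \<open>j \<in> B\<close> kB cross in \<open>simp_all add: B'_def B1_def\<close>)
    qed
    have card': "card B' = CARD('n)"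
    proof -
      have "card B1 = CARD('n)"
        using card full \<open>j \<in> B\<close> kB by (simp add: B1_def)
      then show ?thesis
        using B1 by (simp add: B'_def)
    qed
    have pos': "0 < w l \<bullet> p" if "l \<in> B'" "l \<noteq> compl_idx k" for l
    proof -
      have "w l \<bullet> p = w1 l \<bullet> p" using that pj by (simp add: w_def inner_diff_left)
      moreover have "0 < w1 l \<bullet> p"
        using that ratio[of l] kB pos[OF kB(1,2)]
        by (auto simp: w1_def B'_def B1_def inner_diff_left t_def)
      ultimately show ?thesis by simp
    qed
    have m: "compl_idx k \<in> B'" "w (compl_idx k) = (1 / b) *\<^sub>R y j"
      by (auto simp: w_def B'_def)
    show ?thesis
      by (rule crossing_cone[OF cB' card' exp' m b], erule (1) pos', rule that)
  qed
qed

section \<open>Generic perturbation\<close>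

lemma card_atMost_inj:
  fixes i k :: "'n::{finite,linorder}"
  assumes "card {j. j \<le> i} = card {j. j \<le> k}"
  shows "i = k"
proof (rule ccontr)
  assume "i \<noteq> k"
  then have "{j. j \<le> i} \<subset> {j. j \<le> k} \<or> {j. j \<le> k} \<subset> {j. j \<le> i}"
    by (cases i k rule: linorder_cases) (force simp: psubset_eq)+
  then show False
    using assms psubset_card_mono[of "{j. j \<le> k}" "{j. j \<le> i}"]
      psubset_card_mono[of "{j. j \<le> i}" "{j. j \<le> k}"] by auto
qed

text \<open>The exponents in \<open>eps_vec\<close> are distinct and positive, so the entries of
  \<open>a\<close> and the constant \<open>b\<close> are separate coefficients of the
  polynomial.\<close>

lemma inner_eps_vec_poly:
  fixes a :: "'n::{finite,linorder} rvec"
  obtains p where "\<And>\<epsilon>. a \<bullet> eps_vec \<epsilon> + b = poly p \<epsilon>" "p = 0 \<Longrightarrow> a = 0 \<and> b = 0"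
proof -
  define N where "N i = card {j. j \<le> i}" for i :: 'n
  define p where "p = [:b:] + (\<Sum>i\<in>UNIV. monom (a $ i) (N i))"
  have N: "N i \<noteq> 0" for i by (auto simp: N_def)
  have Ninj: "i = k" if "N i = N k" for i k
    using card_atMost_inj that unfolding N_def by blast
  have "a \<bullet> eps_vec \<epsilon> + b = poly p \<epsilon>" for \<epsilon>
    by (simp add: p_def poly_sum poly_monom inner_vec_def eps_vec_def N_def)
  moreover have "a = 0 \<and> b = 0" if "p = 0"
  proof
    have "coeff p (N i) = a $ i" for i
    proof -
      have "coeff p (N i) = (\<Sum>k\<in>UNIV. if N k = N i then a $ k else 0)"
        using N[of i] by (cases "N i") (auto simp: p_def coeff_sum)
      also have "\<dots> = (\<Sum>k\<in>UNIV. if k = i then a $ k else 0)"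
        by (rule sum.cong) (auto dest: Ninj)
      finally show ?thesis by simp
    qed
    then show "a = 0" using that by (simp add: vec_eq_iff)
    have "coeff p 0 = b"
      by (simp add: p_def coeff_sum N)
    then show "b = 0" using that by simp
  qed
  ultimately show ?thesis by (rule that)
qed

lemma eventually_sgn_poly:
  fixes p :: "real poly"
  assumes "p \<noteq> 0"
  shows "(\<forall>\<^sub>F x in at_right 0. 0 < poly p x) \<or> (\<forall>\<^sub>F x in at_right 0. poly p x < 0)"
proof -
  \<comment> \<open>The sign is constant up to the smallest positive root; the inserted 1 serves
    when there is none.\<close>
  define \<delta> where "\<delta> = Min (insert 1 {x. poly p x = 0 \<and> 0 < x})"
  have fin: "finite {x. poly p x = 0 \<and> 0 < x}"
    using poly_roots_finite[OF assms] by (rule rev_finite_subset) auto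
  have \<delta>: "0 < \<delta>" unfolding \<delta>_def using fin by (subst Min_gr_iff) auto
  have nr: "poly p x \<noteq> 0" if "0 < x" "x < \<delta>" for x
    using that fin Min_le[of "insert 1 {x. poly p x = 0 \<and> 0 < x}" x] by (auto simp: \<delta>_def)
  have same: "0 < poly p x * poly p (\<delta>/2)" if "0 < x" "x < \<delta>" for x
  proof (rule ccontr)
    assume "\<not> ?thesis"
    then have neg: "poly p x * poly p (\<delta>/2) < 0"
      using nr[OF that] nr[of "\<delta>/2"] \<delta> by (simp add: not_less less_le)
    then have "x \<noteq> \<delta>/2" by (auto simp: mult_less_0_iff)
    then consider "x < \<delta>/2" | "\<delta>/2 < x" by linarith
    then show False
    proof cases
      case 1
      then obtain z where "x < z" "z < \<delta>/2" "poly p z = 0"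
        using poly_IVT[of x "\<delta>/2" p] neg by auto
      then show False using nr[of z] that \<delta> by auto
    next
      case 2
      then obtain z where "\<delta>/2 < z" "z < x" "poly p z = 0"
        using poly_IVT[of "\<delta>/2" x p] neg by (auto simp: mult.commute)
      then show False using nr[of z] that \<delta> by auto
    qed
  qed
  have "poly p (\<delta>/2) \<noteq> 0" using nr[of "\<delta>/2"] \<delta> by simp
  then consider "0 < poly p (\<delta>/2)" | "poly p (\<delta>/2) < 0" by linarith
  then show ?thesis
  proof cases
    case 1
    then have "\<forall>x>0. x < \<delta> \<longrightarrow> 0 < poly p x"
      using same by (auto simp: zero_less_mult_iff)
    then show ?thesis
      using \<delta> eventually_at_right[of 0 "1::real" "\<lambda>x. 0 < poly p x"] by auto
  next
    case 2
    then have "\<forall>x>0. x < \<delta> \<longrightarrow> poly p x < 0"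
      using same by (auto simp: zero_less_mult_iff)
    then show ?thesis
      using \<delta> eventually_at_right[of 0 "1::real" "\<lambda>x. poly p x < 0"] by auto
  qed
qed

lemma eventually_eps_vec_le:
  fixes a :: "'n::{finite,linorder} rvec"
  shows "(\<forall>\<^sub>F \<epsilon> in at_right 0. a \<bullet> (q + eps_vec \<epsilon>) \<le> b) \<or> (\<forall>\<^sub>F \<epsilon> in at_right 0. \<not> a \<bullet> (q + eps_vec \<epsilon>) \<le> b)"
proof -
  obtain p where p: "\<And>\<epsilon>. a \<bullet> eps_vec \<epsilon> + (a \<bullet> q - b) = poly p \<epsilon>"
    using inner_eps_vec_poly by metis
  have eq: "a \<bullet> (q + eps_vec \<epsilon>) \<le> b \<longleftrightarrow> poly p \<epsilon> \<le> 0" for \<epsilon>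
    unfolding p[symmetric] by (simp add: inner_add_right algebra_simps)
  show ?thesis
    unfolding eq
  proof (cases "p = 0")
    case False
    from eventually_sgn_poly[OF this]
    show "(\<forall>\<^sub>F \<epsilon> in at_right 0. poly p \<epsilon> \<le> 0) \<or> (\<forall>\<^sub>F \<epsilon> in at_right 0. \<not> poly p \<epsilon> \<le> 0)"
      by (auto elim: eventually_mono simp: not_le)
  qed simp
qed

text \<open>Each of the finitely many halfspaces is decided by the sign of a polynomial in
  \<epsilon>, and one that eventually excludes the point excludes it from \<open>P\<close>.\<close>

lemma eventually_eps_vec_polyhedron:
  fixes P :: "'n::{finite,linorder} rvec set"
  assumes "polyhedron P"
  shows "(\<forall>\<^sub>F \<epsilon> in at_right 0. q + eps_vec \<epsilon> \<in> P) \<or> (\<forall>\<^sub>F \<epsilon> in at_right 0. q + eps_vec \<epsilon> \<notin> P)"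
proof -
  obtain F where F: "finite F" "P = \<Inter>F" "\<And>h. h \<in> F \<Longrightarrow> \<exists>a b. a \<noteq> 0 \<and> h = {x. a \<bullet> x \<le> b}"
    using assms unfolding polyhedron_def by blast
  have dec: "(\<forall>\<^sub>F \<epsilon> in at_right 0. q + eps_vec \<epsilon> \<in> h) \<or> (\<forall>\<^sub>F \<epsilon> in at_right 0. q + eps_vec \<epsilon> \<notin> h)"
    if "h \<in> F" for h
    using F(3)[OF that] eventually_eps_vec_le by fastforce
  show ?thesis
  proof (cases "\<forall>h\<in>F. \<forall>\<^sub>F \<epsilon> in at_right 0. q + eps_vec \<epsilon> \<in> h")
    case True
    then show ?thesis
      unfolding F(2) using eventually_ball_finite[OF F(1)] by (auto simp: Inter_iff)
  next
    case False
    then obtain h where h: "h \<in> F" "\<forall>\<^sub>F \<epsilon> in at_right 0. q + eps_vec \<epsilon> \<notin> h"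
      using dec by blast
    have "\<forall>\<^sub>F \<epsilon> in at_right 0. q + eps_vec \<epsilon> \<notin> P"
      using h(2) by eventually_elim (use h(1) F(2) in auto)
    then show ?thesis ..
  qed
qed

text \<open>One direction of Minkowski-Weyl: a box cuts the cone down to a polytope, and every
  element of the cone can be scaled into the box.\<close>

lemma polyhedral_cone_finitely_generated:
  fixes C :: "'a::euclidean_space set"
  assumes "polyhedron C" "convex_cone C"
  obtains V where "finite V" "C = convex_cone hull V"
proof -
  let ?K = "C \<inter> cbox (-One) One"
  have "polytope ?K"
    unfolding polytope_eq_bounded_polyhedron using assms(1) by (auto intro: bounded_subset)
  then obtain V where V: "finite V" "?K = convex hull V"
    unfolding polytope_def by blast
  have "C = convex_cone hull V"
  proof
    have "V \<subseteq> C" using V(2) hull_subset[of V convex] by blast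
    then show "convex_cone hull V \<subseteq> C"
      using assms(2) by (simp add: hull_minimal)
    show "C \<subseteq> convex_cone hull V"
    proof
      fix x assume x: "x \<in> C"
      define t where "t = 1 / (norm x + 1)"
      have t: "0 < t" "t * (norm x + 1) = 1"
        using add_nonneg_pos[OF norm_ge_zero[of x] zero_less_one] by (auto simp: t_def)
      have nt: "norm (t *\<^sub>R x) \<le> 1"
        using t by (simp add: algebra_simps)
      have "t *\<^sub>R x \<in> cbox (-One) One"
        unfolding mem_box
      proof
        fix i :: 'a assume "i \<in> Basis"
        then have "\<bar>(t *\<^sub>R x) \<bullet> i\<bar> \<le> 1"
          using Basis_le_norm[of i "t *\<^sub>R x"] nt by linarith
        then show "-One \<bullet> i \<le> (t *\<^sub>R x) \<bullet> i \<and> (t *\<^sub>R x) \<bullet> i \<le> One \<bullet> i"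
          using \<open>i \<in> Basis\<close> by (simp add: abs_le_iff)
      qed
      moreover have "t *\<^sub>R x \<in> C"
        using x assms(2) t by (simp add: convex_cone_def conic_mul)
      ultimately have "t *\<^sub>R x \<in> convex_cone hull V"
        using V(2) convex_hull_subset_convex_cone_hull by blast
      then have "(1/t) *\<^sub>R t *\<^sub>R x \<in> convex_cone hull V"
        by (rule convex_cone_hull_mul) (use t in simp)
      moreover have "(1/t) *\<^sub>R t *\<^sub>R x = x" using t(1) by simp
      ultimately show "x \<in> convex_cone hull V" by simp
    qed
  qed
  with V(1) show ?thesis by (rule that)
qed

text \<open>Generators of a sum are obtained by uniting generators. With \<open>D\<close> the column
  space of \<open>Q\<close>, this amounts to projecting the cone along the parameter
  directions.\<close>

lemma polyhedron_cone_sums: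
  fixes C D :: "'a::euclidean_space set"
  assumes "polyhedron C" "convex_cone C" "polyhedron D" "convex_cone D"
  shows "polyhedron (\<Union>x\<in>C. \<Union>y\<in>D. {x + y})"
proof -
  obtain V W where "finite V" "C = convex_cone hull V" "finite W" "D = convex_cone hull W"
    using polyhedral_cone_finitely_generated assms by metis
  then show ?thesis
    using polyhedron_convex_cone_hull[of "V \<union> W"] by (simp add: convex_cone_hull_Un)
qed

section \<open>Slices of polyhedral cones by the perturbed space\<close>

lemma polyhedron_polycone:
  assumes "finite N"
  shows "polyhedron (polycone N)"
proof -
  have "polycone N = \<Inter>((\<lambda>a. {x. a \<bullet> x \<ge> 0}) ` N)"
    by (auto simp: polycone_def)
  moreover have "polyhedron \<dots>"
    by (rule polyhedron_Inter) (use assms polyhedron_halfspace_ge in auto)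
  ultimately show ?thesis by simp
qed

lemma convex_cone_polycone: "convex_cone (polycone N)"
  by (auto simp: polycone_def convex_cone_iff inner_add_right)

lemma mem_Seps: "x \<in> Seps Q q \<epsilon> \<longleftrightarrow> x - (q + eps_vec \<epsilon>) \<in> range ((*v) Q)"
  by (auto simp: Seps_def Sset_def image_iff algebra_simps)

lemma subspace_range_matrix: "subspace (range ((*v) (Q :: ('n::finite, 'd::finite) rmat)))"
  by (intro linear_subspace_image matrix_vector_mul_linear subspace_UNIV)

text \<open>The slice is nonempty iff \<open>q + eps_vec \<epsilon>\<close> lies in the sum of the
  cone and the column space of \<open>Q\<close>, a polyhedron independent of \<epsilon>.\<close>

lemma eventually_polycone_Seps_nonempty:
  fixes Q :: "('n::{finite,linorder}, 'd::finite) rmat"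
  assumes "finite N"
  shows "(\<forall>\<^sub>F \<epsilon> in at_right 0. polycone N \<inter> Seps Q q \<epsilon> \<noteq> {}) \<or>
         (\<forall>\<^sub>F \<epsilon> in at_right 0. polycone N \<inter> Seps Q q \<epsilon> = {})"
proof -
  let ?R = "range ((*v) Q)"
  let ?P = "\<Union>x\<in>polycone N. \<Union>y\<in>?R. {x + y}"
  have "polyhedron ?P"
    using subspace_range_matrix[of Q] assms
    by (intro polyhedron_cone_sums polyhedron_polycone convex_cone_polycone affine_imp_polyhedron
        subspace_imp_affine subspace_imp_convex_cone)
  moreover have "q + eps_vec \<epsilon> \<in> ?P \<longleftrightarrow> polycone N \<inter> Seps Q q \<epsilon> \<noteq> {}" for \<epsilon>
  proof
    assume "q + eps_vec \<epsilon> \<in> ?P"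
    then obtain x y where xy: "x \<in> polycone N" "y \<in> ?R" "q + eps_vec \<epsilon> = x + y" by auto
    then have "x \<in> Seps Q q \<epsilon>"
      using subspace_neg[OF subspace_range_matrix xy(2)] by (simp add: mem_Seps)
    then show "polycone N \<inter> Seps Q q \<epsilon> \<noteq> {}" using xy by auto
  next
    assume "polycone N \<inter> Seps Q q \<epsilon> \<noteq> {}"
    then obtain x where x: "x \<in> polycone N" "x - (q + eps_vec \<epsilon>) \<in> ?R"
      using mem_Seps by blast
    have "q + eps_vec \<epsilon> = x + - (x - (q + eps_vec \<epsilon>))" by simp
    moreover have "- (x - (q + eps_vec \<epsilon>)) \<in> ?R"
      by (rule subspace_neg[OF subspace_range_matrix x(2)])
    ultimately show "q + eps_vec \<epsilon> \<in> ?P" using x(1) by blast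
  qed
  ultimately show ?thesis
    using eventually_eps_vec_polyhedron[of ?P q] by simp
qed

text \<open>If \<open>L\<close> and the column space of \<open>Q\<close> do not span everything,
  they have a common normal \<open>a \<noteq> 0\<close>; a point in \<open>L\<close> would force
  \<open>a \<bullet> (q + eps_vec \<epsilon>) = 0\<close>, a nontrivial polynomial equation that
  fails for small \<epsilon>.\<close>

lemma eventually_Seps_transversal:
  fixes Q :: "('n::{finite,linorder}, 'd::finite) rmat"
  assumes "subspace L"
  shows "\<forall>\<^sub>F \<epsilon> in at_right 0. L \<inter> Seps Q q \<epsilon> \<noteq> {} \<longrightarrow> (\<forall>x. \<exists>l\<in>L. \<exists>v\<in>range ((*v) Q). x = l + v)"
proof (cases "span (L \<union> range ((*v) Q)) = UNIV")
  case True
  then have "\<exists>l\<in>L. \<exists>v\<in>range ((*v) Q). x = l + v" for x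
    using True assms subspace_range_matrix[of Q] unfolding span_Un span_eq_iff[symmetric]
    by (simp add: set_eq_iff) blast
  then show ?thesis by simp
next
  case False
  then obtain a where a: "a \<noteq> 0" "\<forall>x\<in>span (L \<union> range ((*v) Q)). a \<bullet> x = 0"
    using span_not_UNIV_orthogonal by blast
  obtain p where p: "\<And>\<epsilon>. a \<bullet> eps_vec \<epsilon> + a \<bullet> q = poly p \<epsilon>" "p = 0 \<Longrightarrow> a = 0 \<and> a \<bullet> q = 0"
    using inner_eps_vec_poly[of a "a \<bullet> q"] by blast
  have "p \<noteq> 0" using a p by auto
  then have "\<forall>\<^sub>F \<epsilon> in at_right 0. poly p \<epsilon> \<noteq> 0"
    using eventually_sgn_poly[of p] by (auto elim: eventually_mono)
  then have "\<forall>\<^sub>F \<epsilon> in at_right 0. L \<inter> Seps Q q \<epsilon> = {}"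
  proof eventually_elim
    case (elim \<epsilon>)
    have "poly p \<epsilon> = 0" if "x \<in> L" "x \<in> Seps Q q \<epsilon>" for x
    proof -
      have "a \<bullet> x = 0" "a \<bullet> (x - (q + eps_vec \<epsilon>)) = 0"
        using a(2) that by (auto simp: mem_Seps intro: span_base)
      then show ?thesis
        unfolding p(1)[symmetric] by (simp add: inner_diff_right inner_add_right)
    qed
    then show ?case using elim by auto
  qed
  then show ?thesis by (rule eventually_mono) blast
qed

text \<open>The face of the cone through a point of the perturbed affine space is transversal to it, so
  the point can be pushed into the relative interior of the cone, represented here by \<open>c\<close>.\<close>

lemma eventually_Seps_meets_rel_interior:
  fixes Q :: "('n::{finite,linorder}, 'd::finite) rmat"
  assumes "finite N" "c \<in> polycone N"
    and c0: "\<And>a x. a \<in> N \<Longrightarrow> a \<bullet> c = 0 \<Longrightarrow> x \<in> polycone N \<Longrightarrow> a \<bullet> x = 0"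
  shows "\<forall>\<^sub>F \<epsilon> in at_right 0. polycone N \<inter> Seps Q q \<epsilon> \<noteq> {} \<longrightarrow>
           (\<exists>x\<in>polycone N \<inter> Seps Q q \<epsilon>. \<forall>a\<in>N. 0 < a \<bullet> c \<longrightarrow> 0 < a \<bullet> x)"
proof -
  \<comment> \<open>\<open>L I\<close> is where the constraints in \<open>I\<close> are tight; there
    are finitely many \<open>I\<close>, so one bound on \<epsilon> serves all faces.\<close>
  define L where "L I = {x::'n rvec. \<forall>a\<in>I. a \<bullet> x = 0}" for I
  have subL: "subspace (L I)" for I
    by (auto simp: L_def subspace_def inner_add_right)
  have "\<forall>\<^sub>F \<epsilon> in at_right 0. \<forall>I\<in>Pow N. L I \<inter> Seps Q q \<epsilon> \<noteq> {} \<longrightarrow>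
      (\<forall>x. \<exists>l\<in>L I. \<exists>v\<in>range ((*v) Q). x = l + v)"
    using assms(1) by (intro eventually_ball_finite ballI eventually_Seps_transversal subL) auto
  then show ?thesis
  proof eventually_elim
    case (elim \<epsilon>)
    show ?case
    proof
      assume "polycone N \<inter> Seps Q q \<epsilon> \<noteq> {}"
      then obtain p where p: "p \<in> polycone N" "p \<in> Seps Q q \<epsilon>" by auto
      define I where "I = {a \<in> N. a \<bullet> p = 0}"
      have "p \<in> L I \<inter> Seps Q q \<epsilon>" using p by (auto simp: L_def I_def)
      then have "L I \<inter> Seps Q q \<epsilon> \<noteq> {}" by blast
      moreover have "I \<in> Pow N" by (auto simp: I_def)
      ultimately obtain l v where lv: "l \<in> L I" "v \<in> range ((*v) Q)" "c = l + v"
        using elim by blast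
      have pos: "0 < a \<bullet> p" if "a \<in> N - I" for a
        using that p(1) by (force simp: I_def polycone_def less_le)
      obtain r where r: "0 < r" "\<And>x a. x \<in> ball p r \<Longrightarrow> a \<in> N - I \<Longrightarrow> 0 < a \<bullet> x"
        using ball_inner_pos[of "N - I" "\<lambda>a. a" p] assms(1) pos by auto
      \<comment> \<open>Moving \<open>p\<close> along \<open>v\<close> stays in the perturbed space
        and raises a tight constraint to \<open>t * (a \<bullet> c)\<close>, since \<open>l\<close>
        vanishes under it; \<open>t\<close> is small enough to keep the slack constraints
        positive.\<close>
      define t where "t = r / 2 / (norm v + 1)"
      have t: "0 < t" using r by (simp add: t_def add_nonneg_pos)
      have "norm (t *\<^sub>R v) < r"
      proof -
        have "t * norm v \<le> t * (norm v + 1)" using t by simp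
        also have "\<dots> = r / 2"
          using add_nonneg_pos[OF norm_ge_zero[of v] zero_less_one] by (simp add: t_def field_simps)
        finally show ?thesis using t r by simp
      qed
      then have ball: "p + t *\<^sub>R v \<in> ball p r" by (simp add: dist_norm)
      have a: "a \<bullet> (p + t *\<^sub>R v) = t * (a \<bullet> c)" if "a \<in> I" for a
        using that lv by (simp add: L_def I_def inner_add_right)
      have "p + t *\<^sub>R v - (q + eps_vec \<epsilon>) = (p - (q + eps_vec \<epsilon>)) + t *\<^sub>R v" by simp
      also have "\<dots> \<in> range ((*v) Q)"
        using p(2) lv(2) subspace_range_matrix[of Q]
        by (intro subspace_add subspace_scale) (simp_all only: mem_Seps)
      finally have "p + t *\<^sub>R v \<in> Seps Q q \<epsilon>" by (simp only: mem_Seps)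
      moreover have "p + t *\<^sub>R v \<in> polycone N"
        unfolding polycone_def
      proof (intro CollectI ballI)
        fix b assume "b \<in> N"
        then show "0 \<le> b \<bullet> (p + t *\<^sub>R v)"
          using r(2)[OF ball, of b] a[of b] assms(2) t by (cases "b \<in> I") (auto simp: polycone_def)
      qed
      moreover have "\<forall>a\<in>N. 0 < a \<bullet> c \<longrightarrow> 0 < a \<bullet> (p + t *\<^sub>R v)"
      proof (intro ballI impI)
        fix b assume "b \<in> N" "0 < b \<bullet> c"
        then show "0 < b \<bullet> (p + t *\<^sub>R v)"
          using r(2)[OF ball, of b] a[of b] t by (cases "b \<in> I") auto
      qed
      ultimately show "\<exists>x\<in>polycone N \<inter> Seps Q q \<epsilon>. \<forall>a\<in>N. 0 < a \<bullet> c \<longrightarrow> 0 < a \<bullet> x" by blast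
    qed
  qed
qed

text \<open>Sum one witness for each constraint that is not identically zero on the cone: only
  implicit equalities stay tight at the sum.\<close>

lemma polycone_rel_interior_point:
  assumes "finite N"
  obtains c where "c \<in> polycone N"
    "\<And>a x. a \<in> N \<Longrightarrow> a \<bullet> c = 0 \<Longrightarrow> x \<in> polycone N \<Longrightarrow> a \<bullet> x = 0"
proof -
  have "\<exists>z. z \<in> polycone N \<and> ((\<exists>x\<in>polycone N. a \<bullet> x \<noteq> 0) \<longrightarrow> a \<bullet> z \<noteq> 0)" for a
    using convex_cone_polycone[of N] convex_cone_contains_0 by blast
  then obtain z where z: "\<And>a. z a \<in> polycone N"
    "\<And>a x. x \<in> polycone N \<Longrightarrow> a \<bullet> x \<noteq> 0 \<Longrightarrow> a \<bullet> z a \<noteq> 0"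
    by metis
  show ?thesis
  proof (rule that[of "\<Sum>a\<in>N. z a"])
    show "(\<Sum>a\<in>N. z a) \<in> polycone N"
      using z(1) by (auto simp: polycone_def inner_sum_right intro!: sum_nonneg)
    fix a x assume a: "a \<in> N" "a \<bullet> (\<Sum>a\<in>N. z a) = 0" "x \<in> polycone N"
    have "(\<Sum>b\<in>N. a \<bullet> z b) = 0" using a(2) by (simp add: inner_sum_right)
    then have "a \<bullet> z a = 0"
      using a(1) z(1) by (subst (asm) sum_nonneg_eq_0_iff) (auto simp: assms polycone_def)
    then show "a \<bullet> x = 0" using z(2) a(3) by blast
  qed
qed

text \<open>The slice is a translate of the intersection of \<open>W\<close> with the column space
  of \<open>Q\<close>, so \<epsilon> does not affect its dimension.\<close>

lemma aff_dim_subspace_Int_Seps: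
  fixes Q :: "('n::{finite,linorder}, 'd::finite) rmat"
  assumes "subspace W" "x \<in> W \<inter> Seps Q q \<epsilon>"
  shows "aff_dim (W \<inter> Seps Q q \<epsilon>) = int (dim (W \<inter> range ((*v) Q)))"
proof -
  let ?R = "range ((*v) Q)"
  have R: "subspace ?R" by (rule subspace_range_matrix)
  have "W \<inter> Seps Q q \<epsilon> = (+) x ` (W \<inter> ?R)"
  proof (intro equalityI subsetI)
    fix z assume z: "z \<in> W \<inter> Seps Q q \<epsilon>"
    have "z - x = (z - (q + eps_vec \<epsilon>)) - (x - (q + eps_vec \<epsilon>))" by simp
    also have "\<dots> \<in> ?R" using z assms(2) mem_Seps by (blast intro: subspace_diff[OF R])
    finally have "z - x \<in> W \<inter> ?R" using z assms by (auto intro: subspace_diff)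
    then show "z \<in> (+) x ` (W \<inter> ?R)" by (intro image_eqI[of _ _ "z - x"]) auto
  next
    fix z assume "z \<in> (+) x ` (W \<inter> ?R)"
    then obtain v where v: "v \<in> W" "v \<in> ?R" "z = x + v" by auto
    have "x + v - (q + eps_vec \<epsilon>) = (x - (q + eps_vec \<epsilon>)) + v" by simp
    also have "\<dots> \<in> ?R" using v assms(2) by (intro subspace_add[OF R]) (simp_all only: mem_Seps Int_iff)
    finally show "z \<in> W \<inter> Seps Q q \<epsilon>"
      using v(1,3) assms mem_Seps by (blast intro: subspace_add)
  qed
  then show ?thesis
    using R assms(1) by (simp add: aff_dim_translation_eq aff_dim_subspace subspace_inter)
qed

lemma affine_Seps: "affine (Seps Q q \<epsilon>)"
proof -
  have "Seps Q q \<epsilon> = (+) (q + eps_vec \<epsilon>) ` range ((*v) Q)"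
    by (auto simp: mem_Seps image_iff) (metis add_diff_cancel_left' diff_add_cancel add.commute rangeI)
  then show ?thesis
    using affine_translation subspace_imp_affine[OF subspace_range_matrix] by metis
qed

lemma eventually_aff_dim_polycone_Seps:
  fixes Q :: "('n::{finite,linorder}, 'd::finite) rmat"
  assumes "finite N"
  obtains k where "\<forall>\<^sub>F \<epsilon> in at_right 0. aff_dim (polycone N \<inter> Seps Q q \<epsilon>) = k"
proof (cases "\<forall>\<^sub>F \<epsilon> in at_right 0. polycone N \<inter> Seps Q q \<epsilon> = {}")
  case True
  \<comment> \<open>The affine dimension of the empty set is -1.\<close>
  then show ?thesis
    by (intro that[of "-1"]) (auto elim: eventually_mono)
next
  case False
  then have ne: "\<forall>\<^sub>F \<epsilon> in at_right 0. polycone N \<inter> Seps Q q \<epsilon> \<noteq> {}"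
    using eventually_polycone_Seps_nonempty[OF assms] by blast
  obtain c where c: "c \<in> polycone N"
    "\<And>a x. a \<in> N \<Longrightarrow> a \<bullet> c = 0 \<Longrightarrow> x \<in> polycone N \<Longrightarrow> a \<bullet> x = 0"
    using polycone_rel_interior_point[OF assms] by blast
  \<comment> \<open>\<open>W\<close> is the linear hull of the cone, and inside the open set
    \<open>U\<close> the two coincide; so a slice that meets \<open>U\<close> has the dimension of
    the slice of \<open>W\<close>.\<close>
  define W where "W = {x. \<forall>a\<in>N. a \<bullet> c = 0 \<longrightarrow> a \<bullet> x = 0}"
  define U where "U = (\<Inter>a\<in>{a\<in>N. 0 < a \<bullet> c}. {x. 0 < a \<bullet> x})"
  have W: "subspace W" by (auto simp: W_def subspace_def inner_add_right)
  have "open U" unfolding U_def using assms open_halfspace_gt[of 0] by (intro open_INT) auto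
  have CW: "polycone N \<subseteq> W" using c(2) by (auto simp: W_def)
  have WU: "W \<inter> U \<subseteq> polycone N"
    using c(1) by (force simp: W_def U_def polycone_def less_le)
  have "\<forall>\<^sub>F \<epsilon> in at_right 0. polycone N \<inter> Seps Q q \<epsilon> \<noteq> {} \<longrightarrow>
      (\<exists>x\<in>polycone N \<inter> Seps Q q \<epsilon>. \<forall>a\<in>N. 0 < a \<bullet> c \<longrightarrow> 0 < a \<bullet> x)"
    using c by (intro eventually_Seps_meets_rel_interior assms) auto
  with ne have "\<forall>\<^sub>F \<epsilon> in at_right 0. aff_dim (polycone N \<inter> Seps Q q \<epsilon>) = int (dim (W \<inter> range ((*v) Q)))"
  proof eventually_elim
    case (elim \<epsilon>)
    then obtain x where x: "x \<in> polycone N" "x \<in> Seps Q q \<epsilon>" "\<forall>a\<in>N. 0 < a \<bullet> c \<longrightarrow> 0 < a \<bullet> x"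
      by blast
    have "W \<inter> Seps Q q \<epsilon> \<inter> U \<noteq> {}"
      using x CW by (auto simp: U_def)
    moreover have "convex (W \<inter> Seps Q q \<epsilon>)"
      using W affine_Seps by (intro convex_Int subspace_imp_convex affine_imp_convex)
    ultimately have "aff_dim (W \<inter> Seps Q q \<epsilon> \<inter> U) = aff_dim (W \<inter> Seps Q q \<epsilon>)"
      using \<open>open U\<close> by (simp add: aff_dim_convex_Int_open)
    moreover have "aff_dim (W \<inter> Seps Q q \<epsilon> \<inter> U) \<le> aff_dim (polycone N \<inter> Seps Q q \<epsilon>)"
      using WU by (intro aff_dim_subset) auto
    moreover have "aff_dim (polycone N \<inter> Seps Q q \<epsilon>) \<le> aff_dim (W \<inter> Seps Q q \<epsilon>)"
      using CW by (intro aff_dim_subset) auto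
    moreover have "aff_dim (W \<inter> Seps Q q \<epsilon>) = int (dim (W \<inter> range ((*v) Q)))"
      using x CW by (intro aff_dim_subspace_Int_Seps[OF W, of x]) auto
    ultimately show ?case by linarith
  qed
  then show ?thesis by (rule that)
qed

section \<open>Walking along a generic segment\<close>

text \<open>Pigeonhole on a segment from \<open>y\<close>, outside the other members, to
  \<open>x\<close>, outside \<open>A\<close>: it leaves \<open>A\<close> at once, so two of its
  points share another member, and the line through them puts \<open>y\<close> into that
  member.\<close>

lemma convex_subset_finite_Union_affine:
  fixes C :: "'a::real_vector set"
  assumes "finite T" "\<And>A. A \<in> T \<Longrightarrow> affine A" "convex C" "C \<noteq> {}" "C \<subseteq> \<Union>T"
  shows "\<exists>A\<in>T. C \<subseteq> A"
  using assms(1,2,5)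
proof (induction T rule: finite_induct)
  case empty
  then show ?case using assms(4) by simp
next
  case (insert A T)
  show ?case
  proof (rule ccontr)
    assume no: "\<not> ?case"
    then obtain x where x: "x \<in> C" "x \<notin> A" by blast
    have "\<not> C \<subseteq> \<Union>T" using insert no by blast
    then obtain y where y: "y \<in> C" "y \<notin> \<Union>T" by blast
    then have "y \<in> A" using insert.prems by blast
    define f where "f s = (1 - s) *\<^sub>R y + s *\<^sub>R x" for s :: real
    have "f s \<in> \<Union>T" if "s \<in> {0<..1}" for s
    proof -
      have "f s \<in> C" unfolding f_def using that x y assms(3) by (intro convexD) auto
      moreover have "f s \<notin> A"
      proof
        assume "f s \<in> A"
        then have "(1/s) *\<^sub>R f s + (1 - 1/s) *\<^sub>R y \<in> A"
          using \<open>y \<in> A\<close> insert.prems(1) by (intro mem_affine) auto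
        also have "(1/s) *\<^sub>R f s + (1 - 1/s) *\<^sub>R y = x"
          using that by (simp add: f_def algebra_simps diff_divide_distrib)
        finally show False using x by simp
      qed
      ultimately show ?thesis using insert.prems by blast
    qed
    then have "\<forall>s\<in>{0<..1}. \<exists>A. A \<in> T \<and> f s \<in> A" by blast
    from bchoice[OF this] obtain g where g: "\<And>s. s \<in> {0<..1} \<Longrightarrow> g s \<in> T \<and> f s \<in> g s"
      by blast
    have "finite (g ` {0<..1})"
      using g by (intro finite_subset[OF _ insert.hyps(1)]) blast
    moreover have "infinite {0<..1::real}" by simp
    ultimately have "\<not> inj_on g {0<..1}" using finite_imageD by blast
    then obtain s s' where s: "s \<in> {0<..1}" "s' \<in> {0<..1}" "g s = g s'" "s \<noteq> s'"
      by (auto simp: inj_on_def)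
    \<comment> \<open>The affine combination of the parameters \<open>s\<close> and
      \<open>s'\<close> that gives 0, the parameter of \<open>y\<close>.\<close>
    define \<alpha> \<beta> where "\<alpha> = s' / (s' - s)" and "\<beta> = - s / (s' - s)"
    have one: "\<alpha> + \<beta> = 1"
      using s(4) by (simp add: \<alpha>_def \<beta>_def diff_divide_distrib[symmetric])
    have zero: "\<alpha> * s + \<beta> * s' = 0"
      by (simp add: \<alpha>_def \<beta>_def)
    have "\<alpha> *\<^sub>R f s + \<beta> *\<^sub>R f s' \<in> g s"
      using g[OF s(1)] g[OF s(2)] s(3) insert.prems(1) by (intro mem_affine[OF _ _ _ one]) auto
    also have "\<alpha> *\<^sub>R f s + \<beta> *\<^sub>R f s'
        = (\<alpha> + \<beta> - (\<alpha> * s + \<beta> * s')) *\<^sub>R y + (\<alpha> * s + \<beta> * s') *\<^sub>R x"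
      by (simp add: f_def algebra_simps)
    also have "\<dots> = y" by (simp add: one zero)
    finally have "y \<in> g s" .
    then show False using y(2) g[OF s(1)] by blast
  qed
qed

text \<open>A nonempty relatively open part of \<open>S\<close> has affine hull \<open>S\<close>, so
  a subspace containing that part would contain \<open>S\<close>.\<close>

lemma open_affine_avoids_subspaces:
  fixes S :: "'a::euclidean_space set"
  assumes "affine S" "open U" "convex U" "S \<inter> U \<noteq> {}" "finite \<L>"
    and "\<And>L. L \<in> \<L> \<Longrightarrow> subspace L" "\<And>L. L \<in> \<L> \<Longrightarrow> \<not> S \<subseteq> L"
  obtains x where "x \<in> S" "x \<in> U" "\<And>L. L \<in> \<L> \<Longrightarrow> x \<notin> L"
proof -
  have "\<not> S \<inter> U \<subseteq> \<Union>\<L>"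
  proof
    assume "S \<inter> U \<subseteq> \<Union>\<L>"
    then obtain L where L: "L \<in> \<L>" "S \<inter> U \<subseteq> L"
      using convex_subset_finite_Union_affine[of \<L> "S \<inter> U"] assms
      by (metis affine_imp_convex convex_Int subspace_imp_affine)
    have "S = affine hull (S \<inter> U)"
      using affine_hull_affine_Int_open[OF assms(1,2,4)] assms(1) by (metis affine_hull_eq)
    also have "\<dots> \<subseteq> L"
      using L assms(6) by (intro hull_minimal) (auto intro: subspace_imp_affine)
    finally show False using assms(7) L by blast
  qed
  then show ?thesis using that by blast
qed

section \<open>Cones met by a segment\<close>

lemma interior_compl_cone:
  assumes "dual_family M B y"
  shows "interior (compl_cone M B) = {x. \<forall>k\<in>B. 0 < y k \<bullet> x}"
proof
  have "open (\<Inter>k\<in>B. {x. 0 < y k \<bullet> x})"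
    using open_halfspace_gt[of 0] by (intro open_INT) auto
  moreover have "(\<Inter>k\<in>B. {x. 0 < y k \<bullet> x}) = {x. \<forall>k\<in>B. 0 < y k \<bullet> x}" by auto
  ultimately show "{x. \<forall>k\<in>B. 0 < y k \<bullet> x} \<subseteq> interior (compl_cone M B)"
    by (intro interior_maximal)
      (auto simp: compl_cone_eq_polycone[OF assms] polycone_def less_imp_le)
  show "interior (compl_cone M B) \<subseteq> {x. \<forall>k\<in>B. 0 < y k \<bullet> x}"
  proof (intro subsetI CollectI ballI)
    fix x k assume x: "x \<in> interior (compl_cone M B)" and k: "k \<in> B"
    have yk: "y k \<noteq> 0" using dual_family_inner[OF assms k k] by auto
    have "interior (compl_cone M B) \<subseteq> interior {x. 0 \<le> y k \<bullet> x}"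
      using k by (intro interior_mono) (auto simp: compl_cone_eq_polycone[OF assms] polycone_def)
    then show "0 < y k \<bullet> x"
      using x interior_halfspace_ge[OF yk, of 0] by auto
  qed
qed

lemma closed_convex_compl_cone:
  assumes "compl_basis M B"
  shows "closed (compl_cone M B)" "convex (compl_cone M B)"
proof -
  obtain y where "dual_family M B y"
    using compl_basis_dual_family[OF assms] .
  then have "compl_cone M B = polycone (y ` B)"
    by (rule compl_cone_eq_polycone)
  then show "closed (compl_cone M B)" "convex (compl_cone M B)"
    using polyhedron_polycone[of "y ` B"] by (auto intro: polyhedron_imp_closed polyhedron_imp_convex)
qed

text \<open>Meeting the interior, rather than just the cone, makes the slice by an affine space
  containing the segment full-dimensional in that space, as V^eps demands.\<close>

definition traversed :: "('n::finite, 'n) rmat \<Rightarrow> 'n rvec \<Rightarrow> 'n rvec \<Rightarrow> ('n + 'n) set \<Rightarrow> bool" where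
  "traversed M x1 x2 B \<longleftrightarrow>
     compl_basis M B \<and> interior (compl_cone M B) \<inter> closed_segment x1 x2 \<noteq> {}"

text \<open>The segment leaves the first cone at \<open>p\<close> through a common facet with normal \<open>a\<close>; the point
  \<open>u\<close> witnesses that it crosses the facet properly.\<close>

definition crossing :: "('n::finite, 'n) rmat \<Rightarrow> 'n rvec \<Rightarrow> 'n rvec \<Rightarrow> ('n + 'n) set \<Rightarrow> ('n + 'n) set \<Rightarrow> bool" where
  "crossing M x1 x2 B B' \<longleftrightarrow> traversed M x1 x2 B \<and> traversed M x1 x2 B' \<and>
     (\<exists>a p u r. 0 < r \<and> p \<in> closed_segment x1 x2 \<and> a \<bullet> p = 0 \<and>
        u \<in> closed_segment x1 x2 \<and> u \<in> compl_cone M B' \<and> a \<bullet> u < 0 \<and>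
        (\<forall>x\<in>ball p r. a \<bullet> x = 0 \<longrightarrow> x \<in> compl_cone M B \<inter> compl_cone M B') \<and>
        (\<forall>x\<in>compl_cone M B. 0 \<le> a \<bullet> x) \<and> (\<forall>x\<in>compl_cone M B'. a \<bullet> x \<le> 0))"

text \<open>The set \<open>T\<close> of parameters covered by cones reachable from \<open>B1\<close>
  is compact, being a finite union of compact sets, and a maximum below 1 is refuted by the next
  pivot.\<close>

lemma crossing_path:
  fixes M :: "('n::finite, 'n) rmat"
  assumes suff: "sufficient M" and cb: "compl_basis M B1" "compl_basis M B2"
    and x1: "x1 \<in> interior (compl_cone M B1)" and x2: "x2 \<in> interior (compl_cone M B2)"
    and gen: "\<And>J x. card J + 2 \<le> CARD('n) \<Longrightarrow> x \<in> closed_segment x1 x2 \<Longrightarrow> x \<notin> span (Acol M ` J)"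
  shows "(crossing M x1 x2)\<^sup>*\<^sup>* B1 B2"
proof -
  let ?C = "compl_cone M"
  define R where "R = {B. (crossing M x1 x2)\<^sup>*\<^sup>* B1 B}"
  define g where "g t = (1 - t) *\<^sub>R x1 + t *\<^sub>R x2" for t
  have gseg: "g t \<in> closed_segment x1 x2" if "0 \<le> t" "t \<le> 1" for t
    using that by (auto simp: g_def closed_segment_def)
  have inner_g: "a \<bullet> g t = a \<bullet> x1 + t * (a \<bullet> x2 - a \<bullet> x1)" for a t
    by (simp add: g_def inner_add_right algebra_simps)
  have trav1: "traversed M x1 x2 B1"
    using cb(1) x1 by (auto simp: traversed_def)
  have trav: "traversed M x1 x2 B" if "B \<in> R" for B
  proof -
    have "(crossing M x1 x2)\<^sup>*\<^sup>* B1 B" using that by (simp add: R_def)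
    then show ?thesis
      by (cases rule: rtranclp.cases) (use trav1 in \<open>auto simp: crossing_def\<close>)
  qed
  define T where "T = (\<Union>B\<in>R. {0..1} \<inter> g -` ?C B)"
  have "compact ({0..1} \<inter> g -` ?C B)" if "B \<in> R" for B
  proof -
    have "closed (?C B)" using trav[OF that] closed_convex_compl_cone by (auto simp: traversed_def)
    then have "closed (g -` ?C B)"
      by (rule continuous_closed_vimage) (unfold g_def, intro continuous_intros)
    then show ?thesis by (intro compact_Int_closed) auto
  qed
  then have "compact T" unfolding T_def by (intro compact_UN) auto
  moreover have "0 \<in> T"
    using x1 interior_subset[of "?C B1"] by (auto simp: T_def R_def g_def intro!: exI[of _ B1])
  ultimately obtain t where t: "t \<in> T" "\<And>s. s \<in> T \<Longrightarrow> s \<le> t"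
    using compact_attains_sup[of T] by blast
  obtain B where B: "B \<in> R" "0 \<le> t" "t \<le> 1" "g t \<in> ?C B"
    using t(1) by (auto simp: T_def)
  have cB: "compl_basis M B" using trav[OF B(1)] by (simp add: traversed_def)
  obtain y where y: "dual_family M B y"
    using compl_basis_dual_family[OF cB] .
  have C: "?C B = polycone (y ` B)" by (rule compl_cone_eq_polycone[OF y])
  show ?thesis
  proof (cases "t = 1")
    case True
    obtain y2 where y2: "dual_family M B2 y2"
      using compl_basis_dual_family[OF cb(2)] .
    have "B = B2"
    proof (rule compl_cone_interior_unique[OF _ cb(2) cB y2])
      show "column_sufficient M" using suff by (simp add: sufficient_def)
      show "x2 \<in> ?C B" using B(4) True by (simp add: g_def)
      show "0 < y2 k \<bullet> x2" if "k \<in> B2" for k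
        using x2 that by (simp add: interior_compl_cone[OF y2])
    qed
    then show ?thesis using B(1) by (simp add: R_def)
  next
    case False
    then have "t < 1" using B(3) by simp
    define N where "N = norm (x2 - x1) + 1"
    have N: "0 < N" by (simp add: N_def add_nonneg_pos)
    have step: "\<exists>s>t. s \<le> 1 \<and> g s \<in> ball (g t) r" if "0 < r" for r
    proof -
      define e where "e = min (1 - t) (r / 2 / N)"
      have e: "0 < e" "e \<le> 1 - t" "e \<le> r / 2 / N" using \<open>t < 1\<close> that N by (auto simp: e_def)
      have "g t - g (t + e) = - (e *\<^sub>R (x2 - x1))" by (simp add: g_def algebra_simps)
      then have "dist (g t) (g (t + e)) = e * norm (x2 - x1)"
        using e by (simp add: dist_norm)
      also have "\<dots> \<le> e * N" using e by (simp add: N_def)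
      also have "\<dots> \<le> r / 2" using e(3) N by (simp add: field_simps)
      finally have "dist (g t) (g (t + e)) < r" using that by linarith
      then show ?thesis using e by (intro exI[of _ "t + e"]) auto
    qed
    have nn: "0 \<le> y k \<bullet> g t" if "k \<in> B" for k
      using B(4) that by (simp add: C polycone_def)
    have "\<exists>j\<in>B. y j \<bullet> g t = 0"
    proof (rule ccontr)
      assume "\<not> ?thesis"
      then have "0 < y k \<bullet> g t" if "k \<in> B" for k
        using nn that by (metis less_le)
      then obtain r where r: "0 < r" "\<And>x k. x \<in> ball (g t) r \<Longrightarrow> k \<in> B \<Longrightarrow> 0 < y k \<bullet> x"
        using ball_inner_pos[of B y "g t"] by auto
      obtain s where s: "t < s" "s \<le> 1" "g s \<in> ball (g t) r" using step[OF r(1)] by blast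
      have "g s \<in> ?C B"
        using r(2)[OF s(3)] by (auto simp: C polycone_def less_imp_le)
      then have "s \<in> T" using s B by (auto simp: T_def)
      then show False using t(2) s(1) by fastforce
    qed
    then obtain j where j: "j \<in> B" "y j \<bullet> g t = 0" by blast
    \<comment> \<open>Two vanishing coordinates would put \<open>g t\<close> into the span of n - 2
      columns.\<close>
    have pos: "0 < y k \<bullet> g t" if k: "k \<in> B" "k \<noteq> j" for k
    proof (rule ccontr)
      assume "\<not> ?thesis"
      then have k0: "y k \<bullet> g t = 0" using nn[OF k(1)] by simp
      have "g t = (\<Sum>l\<in>B. (y l \<bullet> g t) *\<^sub>R Acol M l)"
        by (rule dual_family_expand[OF y, symmetric])
      also have "\<dots> = (\<Sum>l\<in>B - {j, k}. (y l \<bullet> g t) *\<^sub>R Acol M l)"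
        by (rule sum.mono_neutral_right) (use j k0 in auto)
      also have "\<dots> \<in> span (Acol M ` (B - {j, k}))"
        by (intro span_sum span_scale span_base imageI) auto
      finally have "g t \<in> span (Acol M ` (B - {j, k}))" .
      moreover have "card (B - {j, k}) + 2 \<le> CARD('n)"
      proof -
        have "card {j, k} \<le> card B" using j k by (intro card_mono) auto
        moreover have "card (B - {j, k}) = card B - card {j, k}"
          using j k by (intro card_Diff_subset) auto
        ultimately show ?thesis using cB k(2) by (simp add: compl_basis_def)
      qed
      ultimately show False using gen gseg B by blast
    qed
    \<comment> \<open>At \<open>t0\<close> the coordinate \<open>y j\<close> is positive; it is
      affine along the segment and zero at \<open>t\<close>, hence negative beyond \<open>t\<close>.
      So \<open>x2\<close> is the feasible point on the far side that
      \<open>adjacent_compl_cone\<close> asks for.\<close>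
    obtain t0 where t0: "0 \<le> t0" "t0 \<le> 1" "g t0 \<in> interior (?C B)"
      using trav[OF B(1)] by (auto simp: traversed_def closed_segment_def g_def)
    have yt0: "0 < y j \<bullet> g t0" using t0(3) j(1) by (simp add: interior_compl_cone[OF y])
    have "t0 \<in> T" using t0 B(1) interior_subset[of "?C B"] by (auto simp: T_def)
    then have "t0 < t" using t(2)[of t0] yt0 j(2) by (cases "t0 = t") auto
    have diff: "y j \<bullet> g s - y j \<bullet> g s' = (s - s') * (y j \<bullet> x2 - y j \<bullet> x1)" for s s'
      by (simp add: inner_g algebra_simps)
    have slope: "y j \<bullet> x2 - y j \<bullet> x1 < 0"
      using diff[of t0 t] yt0 j(2) \<open>t0 < t\<close> by (simp add: zero_less_mult_iff)
    have neg: "y j \<bullet> g s < 0" if "t < s" for s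
      using diff[of s t] j(2) slope that by (simp add: mult_pos_neg)
    have x2C: "x2 \<in> ?C B2" using x2 interior_subset by blast
    have x2neg: "y j \<bullet> x2 < 0" using neg[OF \<open>t < 1\<close>] by (simp add: g_def)
    have gent: "g t \<notin> span (Acol M ` J)" if "card J + 2 \<le> CARD('n)" for J
      using gen[OF that] gseg B by blast
    obtain B' r where B': "compl_basis M B'" "0 < r"
      "\<And>x. x \<in> ball (g t) r \<Longrightarrow> y j \<bullet> x \<le> 0 \<Longrightarrow> x \<in> ?C B'"
      "\<And>x. x \<in> ?C B' \<Longrightarrow> y j \<bullet> x \<le> 0"
      by (rule adjacent_compl_cone[OF suff cB y j], erule (1) pos, erule gent, rule x2C, rule x2neg,
          rule that)
    obtain r2 where r2: "0 < r2" "\<And>x k. x \<in> ball (g t) r2 \<Longrightarrow> k \<in> B - {j} \<Longrightarrow> 0 < y k \<bullet> x"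
      using ball_inner_pos[of "B - {j}" y "g t"] pos by auto
    \<comment> \<open>A point just beyond \<open>t\<close> is interior to the new cone, which makes
      that cone reachable and contradicts the maximality of \<open>t\<close>.\<close>
    obtain s where s: "t < s" "s \<le> 1" "g s \<in> ball (g t) r" using step[OF B'(2)] by blast
    have "open (ball (g t) r \<inter> {x. y j \<bullet> x < 0})"
      by (intro open_Int open_ball open_halfspace_lt)
    moreover have "ball (g t) r \<inter> {x. y j \<bullet> x < 0} \<subseteq> ?C B'"
      using B'(3) by auto
    ultimately have gs: "g s \<in> interior (?C B')"
      using s neg[OF s(1)] by (intro interiorI[of "ball (g t) r \<inter> {x. y j \<bullet> x < 0}"]) auto
    have sseg: "g s \<in> closed_segment x1 x2" using s B by (intro gseg) auto
    have "traversed M x1 x2 B'"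
      using B'(1) gs sseg by (auto simp: traversed_def)
    moreover have "x \<in> ?C B \<inter> ?C B'" if "x \<in> ball (g t) (min r r2)" "y j \<bullet> x = 0" for x
    proof
      have "0 \<le> y k \<bullet> x" if "k \<in> B" for k
        using that r2(2)[of x k] \<open>x \<in> _\<close> \<open>y j \<bullet> x = 0\<close> by (cases "k = j") auto
      then show "x \<in> ?C B" by (auto simp: C polycone_def)
      show "x \<in> ?C B'" using B'(3) that by auto
    qed
    moreover have "0 \<le> y j \<bullet> x" if "x \<in> ?C B" for x
      using that j(1) by (auto simp: C polycone_def)
    ultimately have "crossing M x1 x2 B B'"
      unfolding crossing_def
      using trav[OF B(1)] B'(2,4) r2(1) gseg[OF B(2,3)] j(2) sseg gs neg[OF s(1)] interior_subset[of "?C B'"]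
      by (intro conjI exI[of _ "y j"] exI[of _ "g t"] exI[of _ "g s"] exI[of _ "min r r2"]) auto
    then have "B' \<in> R" using B(1) by (auto simp: R_def intro: rtranclp.rtrancl_into_rtrancl)
    then have "s \<in> T" using s B gs interior_subset[of "?C B'"] by (auto simp: T_def)
    then show ?thesis using t(2)[of s] s(1) by simp
  qed
qed

section \<open>Connecting adjacent critical domains\<close>

lemma tendsto_eps_vec: "((eps_vec :: real \<Rightarrow> 'n::{finite,linorder} rvec) \<longlongrightarrow> 0) (at_right 0)"
proof (rule vec_tendstoI)
  fix i :: 'n
  have "{j. j \<le> i} \<noteq> {}" by auto
  then have "(0::real) ^ card {j. j \<le> i} = 0" by (simp add: card_gt_0_iff)
  moreover have "((\<lambda>\<epsilon>::real. \<epsilon> ^ card {j. j \<le> i}) \<longlongrightarrow> 0 ^ card {j. j \<le> i}) (at_right 0)"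
    by (intro tendsto_intros)
  ultimately show "((\<lambda>\<epsilon>. (eps_vec \<epsilon> :: 'n rvec) $ i) \<longlongrightarrow> 0 $ i) (at_right 0)"
    by (simp only: eps_vec_def vec_lambda_beta zero_index)
qed

lemma eventually_at_right_0_iff:
  "(\<exists>\<delta>>0. \<forall>\<epsilon>. 0 < \<epsilon> \<and> \<epsilon> < \<delta> \<longrightarrow> P \<epsilon>) \<longleftrightarrow> (\<forall>\<^sub>F \<epsilon> in at_right (0::real). P \<epsilon>)"
  using eventually_at_right[of 0 "1::real" P] by auto

lemma Sset_eq_translation: "Sset Q q = (+) q ` range ((*v) Q)"
  by (auto simp: Sset_def)

lemma affine_Sset: "affine (Sset Q q)"
  unfolding Sset_eq_translation
  using affine_translation subspace_imp_affine[OF subspace_range_matrix] by metis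

lemma aff_dim_Sset:
  fixes Q :: "('n::finite, 'd::finite) rmat"
  assumes "rank Q = CARD('d)"
  shows "aff_dim (Sset Q q) = int CARD('d)"
proof -
  have "dim (range ((*v) Q)) = CARD('d)"
    using assms by (simp add: rank_dim_range)
  then show ?thesis
    unfolding Sset_eq_translation
    by (simp add: aff_dim_translation_eq aff_dim_subspace[OF subspace_range_matrix])
qed

lemma aff_dim_Seps:
  fixes Q :: "('n::{finite,linorder}, 'd::finite) rmat"
  assumes "rank Q = CARD('d)"
  shows "aff_dim (Seps Q q \<epsilon>) = int CARD('d)"
proof -
  have "Seps Q q \<epsilon> = (+) (eps_vec \<epsilon>) ` Sset Q q"
    by (simp add: Seps_def add.commute)
  then show ?thesis
    using aff_dim_Sset[OF assms] by (simp add: aff_dim_translation_eq)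
qed

lemma Veps_alt:
  fixes Q :: "('n::{finite,linorder}, 'd::finite) rmat"
  shows "B \<in> Veps M Q q \<longleftrightarrow> compl_basis M B \<and>
    (\<forall>\<^sub>F \<epsilon> in at_right 0. aff_dim (compl_cone M B \<inter> Seps Q q \<epsilon>) = int CARD('d))"
  by (simp add: Veps_def eventually_at_right_0_iff)

text \<open>Collecting both dual families gives the intersection as one \<open>polycone\<close>. The
  case \<open>B = B'\<close> serves the vertices, distinct bases the edges.\<close>

lemma eventually_aff_dim_compl_cones:
  fixes Q :: "('n::{finite,linorder}, 'd::finite) rmat"
  assumes "compl_basis M B" "compl_basis M B'"
  shows "\<exists>k. \<forall>\<^sub>F \<epsilon> in at_right 0. aff_dim (compl_cone M B \<inter> compl_cone M B' \<inter> Seps Q q \<epsilon>) = k"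
proof -
  obtain y y' where y: "dual_family M B y" "dual_family M B' y'"
    using compl_basis_dual_family[OF assms(1)] compl_basis_dual_family[OF assms(2)] by (metis (full_types))
  have "compl_cone M B \<inter> compl_cone M B' = polycone (y ` B \<union> y' ` B')"
    unfolding y[THEN compl_cone_eq_polycone] by (auto simp: polycone_def)
  moreover obtain k where "\<forall>\<^sub>F \<epsilon> in at_right 0. aff_dim (polycone (y ` B \<union> y' ` B') \<inter> Seps Q q \<epsilon>) = k"
    by (rule eventually_aff_dim_polycone_Seps[of "y ` B \<union> y' ` B'" Q q]) auto
  ultimately show ?thesis by auto
qed

lemma convex_crit_dom:
  assumes "compl_basis M B"
  shows "convex (crit_dom M Q q B)"
  unfolding crit_dom_def
  by (rule convex_Int[OF closed_convex_compl_cone(2)[OF assms] affine_imp_convex[OF affine_Sset]])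

text \<open>A coordinate that is constant on the parameter space is positive after the perturbation
  because the basis belongs to the perturbed vertex set; any other coordinate is already positive
  at a relative interior point of the critical domain.\<close>

lemma Vfull_perturbed_interior_point:
  fixes Q :: "('n::{finite,linorder}, 'd::finite) rmat"
  assumes rank: "rank Q = CARD('d)" and B: "B \<in> Vfull M Q q"
    and q0: "q0 \<in> crit_dom M Q q B" and "0 < r"
  obtains p where "p \<in> Sset Q q" "dist p q0 < r"
    "\<forall>\<^sub>F \<epsilon> in at_right 0. p + eps_vec \<epsilon> \<in> interior (compl_cone M B)"
proof -
  let ?D = "crit_dom M Q q B" and ?R = "range ((*v) Q)"
  have BV: "B \<in> Veps M Q q" and dimD: "aff_dim ?D = int CARD('d)"
    using B by (auto simp: Vfull_def)
  then have cB: "compl_basis M B" by (simp add: Veps_alt)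
  obtain y where y: "dual_family M B y"
    using compl_basis_dual_family[OF cB] .
  have C: "compl_cone M B = polycone (y ` B)" by (rule compl_cone_eq_polycone[OF y])
  have convD: "convex ?D" by (rule convex_crit_dom[OF cB])
  have DS: "?D \<subseteq> Sset Q q" by (auto simp: crit_dom_def)
  \<comment> \<open>Full dimension makes the affine hull all of \<open>Sset Q q\<close>, so the
    relative interior is taken in that space.\<close>
  have "aff_dim ?D = aff_dim (Sset Q q)" using dimD aff_dim_Sset[OF rank] by simp
  then have hull: "affine hull ?D = Sset Q q"
    using DS affine_Sset[of Q q] q0
    by (metis affine_affine_hull aff_dim_affine_hull affine_dim_equal empty_iff hull_minimal hull_inc)
  have "q0 \<in> closure (rel_interior ?D)"
    using q0 closure_subset convex_closure_rel_interior[OF convD] by blast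
  then obtain p where p: "p \<in> rel_interior ?D" "dist p q0 < r"
    using \<open>0 < r\<close> closure_approachable by blast
  then have pD: "p \<in> ?D" using rel_interior_subset by blast
  then have pS: "p \<in> Sset Q q" using DS by blast
  obtain e where e: "0 < e" "ball p e \<inter> Sset Q q \<subseteq> ?D"
    using p(1) hull by (auto simp: mem_rel_interior_ball)
  have shift: "p + v \<in> Sset Q q" if "v \<in> ?R" for v
  proof -
    obtain w where w: "w \<in> ?R" "p = q + w" using pS by (auto simp: Sset_eq_translation)
    have "w + v \<in> ?R" by (rule subspace_add[OF subspace_range_matrix w(1) that])
    then show ?thesis unfolding Sset_eq_translation w(2) add.assoc by (rule imageI)
  qed
  have nonconst: "0 < y k \<bullet> p" if k: "k \<in> B" and v: "v \<in> ?R" "y k \<bullet> v \<noteq> 0" for k v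
  proof (rule ccontr)
    assume "\<not> 0 < y k \<bullet> p"
    moreover have "0 \<le> y k \<bullet> p" using pD k by (auto simp: crit_dom_def C polycone_def)
    ultimately have p0: "y k \<bullet> p = 0" by simp
    \<comment> \<open>The sign lowers \<open>y k\<close> along \<open>s *\<^sub>R v\<close> and the
      length stays below \<open>e\<close>, so a zero coordinate would turn negative inside the
      domain.\<close>
    define s where "s = - sgn (y k \<bullet> v) * (e / 2 / (norm v + 1))"
    have pos: "0 < norm v + 1" by (simp add: add_nonneg_pos)
    have "\<bar>s\<bar> * norm v < e"
    proof -
      have "\<bar>s\<bar> = e / 2 / (norm v + 1)" using v e pos by (simp add: s_def abs_mult abs_sgn_eq)
      then have "\<bar>s\<bar> * (norm v + 1) = e / 2" using pos by (simp add: field_simps)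
      moreover have "\<bar>s\<bar> * norm v \<le> \<bar>s\<bar> * (norm v + 1)" by (simp add: mult_left_mono)
      ultimately show ?thesis using e by linarith
    qed
    then have "p + s *\<^sub>R v \<in> ball p e" by (simp add: dist_norm)
    moreover have "p + s *\<^sub>R v \<in> Sset Q q"
      by (intro shift subspace_scale[OF subspace_range_matrix] v(1))
    ultimately have "p + s *\<^sub>R v \<in> ?D" using e by blast
    then have "0 \<le> y k \<bullet> (p + s *\<^sub>R v)" using k by (auto simp: crit_dom_def C polycone_def)
    also have "\<dots> = s * (y k \<bullet> v)" using p0 by (simp add: inner_add_right)
    also have "\<dots> = - (e / 2 / (norm v + 1)) * \<bar>y k \<bullet> v\<bar>"
      by (simp add: s_def abs_sgn mult.commute)
    also have "\<dots> < 0" using e pos v(2) by (intro mult_neg_pos) auto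
    finally show False by simp
  qed
  have ne: "\<forall>\<^sub>F \<epsilon> in at_right 0. polycone (y ` B) \<inter> Seps Q q \<epsilon> \<noteq> {}"
    using BV unfolding Veps_alt C by (auto elim!: eventually_mono)
  \<comment> \<open>All coordinates of \<open>c\<close> are 1, so for this \<open>c\<close> every
    constraint becomes strict.\<close>
  define c where "c = (\<Sum>l\<in>B. 1 *\<^sub>R Acol M l)"
  have yc: "y k \<bullet> c = 1" if "k \<in> B" for k
    unfolding c_def by (rule dual_family_sum_right[OF y that])
  have "\<forall>\<^sub>F \<epsilon> in at_right 0. polycone (y ` B) \<inter> Seps Q q \<epsilon> \<noteq> {} \<longrightarrow>
      (\<exists>x\<in>polycone (y ` B) \<inter> Seps Q q \<epsilon>. \<forall>a\<in>y ` B. 0 < a \<bullet> c \<longrightarrow> 0 < a \<bullet> x)"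
    by (rule eventually_Seps_meets_rel_interior) (auto simp: polycone_def yc)
  with ne have int: "\<forall>\<^sub>F \<epsilon> in at_right 0. \<exists>x\<in>Seps Q q \<epsilon>. \<forall>k\<in>B. 0 < y k \<bullet> x"
    by eventually_elim (use yc in fastforce)
  have "\<forall>\<^sub>F \<epsilon> in at_right 0. 0 < y k \<bullet> (p + eps_vec \<epsilon>)" if k: "k \<in> B" for k
  proof (cases "\<exists>v\<in>?R. y k \<bullet> v \<noteq> 0")
    case True
    then have "0 < y k \<bullet> p" using nonconst[OF k] by blast
    moreover have "((\<lambda>\<epsilon>. y k \<bullet> (p + eps_vec \<epsilon>)) \<longlongrightarrow> y k \<bullet> (p + 0)) (at_right 0)"
      by (intro tendsto_intros tendsto_eps_vec)
    ultimately show ?thesis by (auto dest: order_tendstoD(1))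
  next
    case False
    \<comment> \<open>Here \<open>y k\<close> is constant on each perturbed space, so its value can
      be read off at any interior point of the slice.\<close>
    from int show ?thesis
    proof eventually_elim
      case (elim \<epsilon>)
      then obtain x where x: "x \<in> Seps Q q \<epsilon>" "0 < y k \<bullet> x" using k by blast
      obtain w where w: "w \<in> ?R" "p = q + w" using pS by (auto simp: Sset_eq_translation)
      have "x - (q + eps_vec \<epsilon>) \<in> ?R" using x(1) by (simp only: mem_Seps)
      then have "y k \<bullet> (x - (q + eps_vec \<epsilon>)) = 0" "y k \<bullet> w = 0" using False w(1) by blast+
      then have "y k \<bullet> (p + eps_vec \<epsilon>) = y k \<bullet> x"
        by (simp add: w(2) inner_add_right inner_diff_right)
      then show ?case using x(2) by simp
    qed
  qed
  then have "\<forall>\<^sub>F \<epsilon> in at_right 0. \<forall>k\<in>B. 0 < y k \<bullet> (p + eps_vec \<epsilon>)"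
    by (intro eventually_ball_finite) auto
  then have "\<forall>\<^sub>F \<epsilon> in at_right 0. p + eps_vec \<epsilon> \<in> interior (compl_cone M B)"
    by (simp add: interior_compl_cone[OF y])
  with pS p(2) show ?thesis by (rule that)
qed

text \<open>Choose \<open>x1\<close> off the spans in question and \<open>x2\<close> off those spans
  enlarged by \<open>x1\<close>; a bad point of the segment other than \<open>x1\<close> would put
  \<open>x2\<close> into an enlarged span.\<close>

lemma generic_segment:
  fixes M :: "('n::{finite,linorder}, 'n) rmat" and Q :: "('n, 'd::finite) rmat"
  assumes tr: "\<And>J. span (Acol M ` J) \<inter> Seps Q q \<epsilon> \<noteq> {} \<Longrightarrow>
      \<forall>x. \<exists>l\<in>span (Acol M ` J). \<exists>v\<in>range ((*v) Q). x = l + v"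
    and U: "open U1" "convex U1" "Seps Q q \<epsilon> \<inter> U1 \<noteq> {}" "open U2" "convex U2" "Seps Q q \<epsilon> \<inter> U2 \<noteq> {}"
  obtains x1 x2 where "x1 \<in> U1" "x2 \<in> U2" "closed_segment x1 x2 \<subseteq> Seps Q q \<epsilon>"
    "\<And>J x. card J + 2 \<le> CARD('n) \<Longrightarrow> x \<in> closed_segment x1 x2 \<Longrightarrow> x \<notin> span (Acol M ` J)"
proof -
  let ?S = "Seps Q q \<epsilon>"
  \<comment> \<open>Spans that miss the perturbed space miss the segment too.\<close>
  define \<J> where "\<J> = {J. card J + 2 \<le> CARD('n) \<and> span (Acol M ` J) \<inter> ?S \<noteq> {}}"
  \<comment> \<open>If at most n - 1 vectors spanned the perturbed space, they would span its
    directions and, by transversality, all of R^n.\<close>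
  have notsub: "\<not> ?S \<subseteq> span (insert x (Acol M ` J))" if "J \<in> \<J>" for x J
  proof
    let ?L = "span (insert x (Acol M ` J))"
    assume sub: "?S \<subseteq> ?L"
    obtain s where s: "s \<in> ?S" using U(3) by blast
    have vL: "v \<in> ?L" if "v \<in> range ((*v) Q)" for v
    proof -
      have "(s - (q + eps_vec \<epsilon>)) + v \<in> range ((*v) Q)"
        using s that by (intro subspace_add[OF subspace_range_matrix]) (simp_all only: mem_Seps)
      moreover have "(s - (q + eps_vec \<epsilon>)) + v = (s + v) - (q + eps_vec \<epsilon>)" by simp
      ultimately have "s + v \<in> ?S" by (simp only: mem_Seps)
      then have "(s + v) - s \<in> ?L" using sub s by (intro span_diff) auto
      then show ?thesis by simp
    qed
    have "z \<in> ?L" for z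
    proof -
      have "span (Acol M ` J) \<inter> ?S \<noteq> {}" using \<open>J \<in> \<J>\<close> by (simp add: \<J>_def)
      from tr[OF this] obtain l v where lv: "l \<in> span (Acol M ` J)" "v \<in> range ((*v) Q)" "z = l + v"
        by blast
      have "l \<in> ?L" using lv(1) span_mono[of "Acol M ` J" "insert x (Acol M ` J)"] by blast
      then show ?thesis unfolding lv(3) using vL[OF lv(2)] by (rule span_add)
    qed
    then have "UNIV \<subseteq> ?L" by blast
    then have "dim (UNIV :: 'n rvec set) \<le> card (insert x (Acol M ` J))"
      by (intro dim_le_card) auto
    also have "\<dots> \<le> Suc (card (Acol M ` J))" by (simp add: card_insert_if)
    also have "\<dots> \<le> Suc (card J)" by (simp add: card_image_le)
    finally show False using that by (simp add: \<J>_def)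
  qed
  obtain x1 where x1: "x1 \<in> ?S" "x1 \<in> U1" "\<And>L. L \<in> (\<lambda>J. span (Acol M ` J)) ` \<J> \<Longrightarrow> x1 \<notin> L"
  proof (rule open_affine_avoids_subspaces[OF affine_Seps U(1-3)])
    show "\<not> ?S \<subseteq> L" if "L \<in> (\<lambda>J. span (Acol M ` J)) ` \<J>" for L
      using that notsub span_mono[OF subset_insertI] by blast
  qed auto
  obtain x2 where x2: "x2 \<in> ?S" "x2 \<in> U2"
    "\<And>L. L \<in> (\<lambda>J. span (insert x1 (Acol M ` J))) ` \<J> \<Longrightarrow> x2 \<notin> L"
  proof (rule open_affine_avoids_subspaces[OF affine_Seps U(4-6)])
    show "\<not> ?S \<subseteq> L" if "L \<in> (\<lambda>J. span (insert x1 (Acol M ` J))) ` \<J>" for L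
      using that notsub by blast
  qed auto
  have seg: "closed_segment x1 x2 \<subseteq> ?S"
    using x1(1) x2(1) affine_Seps by (intro closed_segment_subset affine_imp_convex)
  have "x \<notin> span (Acol M ` J)" if J: "card J + 2 \<le> CARD('n)" and x: "x \<in> closed_segment x1 x2" for J x
  proof
    assume xL: "x \<in> span (Acol M ` J)"
    then have JJ: "J \<in> \<J>" using J x seg by (auto simp: \<J>_def)
    obtain t where t: "x = (1 - t) *\<^sub>R x1 + t *\<^sub>R x2" using x by (auto simp: closed_segment_def)
    have "t \<noteq> 0" using t xL x1(3) JJ by auto
    then have "x2 = (1/t) *\<^sub>R (x - (1 - t) *\<^sub>R x1)" by (simp add: t)
    also have "\<dots> \<in> span (insert x1 (Acol M ` J))"
      using xL span_mono[of "Acol M ` J" "insert x1 (Acol M ` J)"]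
      by (intro span_scale span_diff) (auto intro: span_base)
    finally show False using x2(3) JJ by blast
  qed
  with x1(2) x2(2) seg show ?thesis by (rule that)
qed

lemma rtranclp_imp_list:
  assumes "R\<^sup>*\<^sup>* a b"
  shows "\<exists>xs. xs \<noteq> [] \<and> hd xs = a \<and> last xs = b \<and> (\<forall>k. k + 1 < length xs \<longrightarrow> R (xs ! k) (xs ! (k + 1)))"
  using assms
proof (induction rule: converse_rtranclp_induct)
  case base
  show ?case by (intro exI[of _ "[b]"]) auto
next
  case (step a a')
  then obtain xs where xs: "xs \<noteq> []" "hd xs = a'" "last xs = b"
    "\<forall>k. k + 1 < length xs \<longrightarrow> R (xs ! k) (xs ! (k + 1))" by blast
  have "R ((a # xs) ! k) ((a # xs) ! (k + 1))" if "k + 1 < length (a # xs)" for k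
    using that xs step(1) by (cases k) (auto simp: hd_conv_nth)
  with xs show ?case by (intro exI[of _ "a # xs"]) auto
qed

theorem mainTheorem14:
  fixes M :: "('n::{finite,linorder}, 'n) rmat" and Q :: "('n, 'd::finite) rmat" and q :: "'n rvec"
    and B1 B2 :: "('n + 'n) set"
  assumes "sufficient M"
    and "rank Q = CARD('d)"
    and "B1 \<in> Vfull M Q q" and "B2 \<in> Vfull M Q q" and "B1 \<noteq> B2"
    and "aff_dim (crit_dom M Q q B1 \<inter> crit_dom M Q q B2) = int CARD('d) - 1"
  shows "\<exists>Bs :: ('n + 'n) set list. Bs \<noteq> [] \<and> hd Bs = B1 \<and> last Bs = B2 \<and>
           (\<forall>k < length Bs. Bs ! k \<in> Veps M Q q) \<and>
           (\<forall>k. k + 1 < length Bs \<longrightarrow> {Bs ! k, Bs ! (k + 1)} \<in> Eeps M Q q) \<and>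
           (\<forall>k < length Bs. aff_dim (crit_dom M Q q (Bs ! k) \<inter> crit_dom M Q q B1
                                     \<inter> crit_dom M Q q B2) = int CARD('d) - 1)"
proof -
  let ?C = "compl_cone M" and ?S = "Seps Q q"
  define F where "F = crit_dom M Q q B1 \<inter> crit_dom M Q q B2"
  define \<B> where "\<B> = {B. compl_basis M B}"
  have cb: "compl_basis M B1" "compl_basis M B2"
    using assms(3,4) by (auto simp: Vfull_def Veps_def)
  have dimF: "aff_dim F = int CARD('d) - 1" using assms(6) by (simp add: F_def)
  \<comment> \<open>The empty set has dimension -1, while d is at least 1.\<close>
  have "F \<noteq> {}"
  proof
    assume "F = {}"
    then have "int CARD('d) = 0" using dimF by simp
    then show False by simp
  qed
  have "convex F"
    unfolding F_def by (intro convex_Int convex_crit_dom cb)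

  \<comment> \<open>Each of these finitely many hulls has smaller dimension than \<open>F\<close>,
    so none contains \<open>F\<close>, and together they cannot cover it.\<close>
  define \<T> where "\<T> = (\<lambda>B. affine hull (?C B \<inter> F)) ` {B \<in> \<B>. aff_dim (?C B \<inter> F) < aff_dim F}"
  have "\<not> F \<subseteq> \<Union>\<T>"
  proof
    assume "F \<subseteq> \<Union>\<T>"
    moreover have "finite \<T>" "\<And>A. A \<in> \<T> \<Longrightarrow> affine A" by (auto simp: \<T>_def)
    ultimately obtain A where A: "A \<in> \<T>" "F \<subseteq> A"
      using convex_subset_finite_Union_affine[of \<T> F] \<open>convex F\<close> \<open>F \<noteq> {}\<close> by blast
    then obtain B where B: "aff_dim (?C B \<inter> F) < aff_dim F" "F \<subseteq> affine hull (?C B \<inter> F)"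
      by (auto simp: \<T>_def)
    then show False using aff_dim_subset[OF B(2)] by simp
  qed
  then obtain q0 where q0: "q0 \<in> F" "q0 \<notin> \<Union>\<T>" by blast
  have dim_q0: "aff_dim (?C B \<inter> F) = int CARD('d) - 1" if "B \<in> \<B>" "q0 \<in> ?C B" for B
  proof -
    have "q0 \<in> affine hull (?C B \<inter> F)" using that q0 by (intro hull_inc) auto
    then have "\<not> aff_dim (?C B \<inter> F) < aff_dim F" using q0(2) that by (auto simp: \<T>_def)
    moreover have "aff_dim (?C B \<inter> F) \<le> aff_dim F" by (intro aff_dim_subset) auto
    ultimately show ?thesis using dimF by simp
  qed

  have "open (\<Inter>B\<in>{B \<in> \<B>. q0 \<notin> ?C B}. - ?C B)"
    using closed_convex_compl_cone by (intro open_INT) (auto simp: \<B>_def)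
  then obtain r where r: "0 < r" "ball q0 r \<subseteq> (\<Inter>B\<in>{B \<in> \<B>. q0 \<notin> ?C B}. - ?C B)"
    using open_contains_ball by (metis (mono_tags, lifting) ComplI INT_I mem_Collect_eq)
  have near: "q0 \<in> ?C B" if "B \<in> \<B>" "x \<in> ball q0 r" "x \<in> ?C B" for B x
    using r(2) that by blast

  have q0D: "q0 \<in> crit_dom M Q q B1" "q0 \<in> crit_dom M Q q B2"
    using q0 by (auto simp: F_def)
  obtain p1 where p1: "p1 \<in> Sset Q q" "dist p1 q0 < r"
    "\<forall>\<^sub>F \<epsilon> in at_right 0. p1 + eps_vec \<epsilon> \<in> interior (?C B1)"
    using Vfull_perturbed_interior_point[OF assms(2,3) q0D(1) r(1)] .
  obtain p2 where p2: "p2 \<in> Sset Q q" "dist p2 q0 < r"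
    "\<forall>\<^sub>F \<epsilon> in at_right 0. p2 + eps_vec \<epsilon> \<in> interior (?C B2)"
    using Vfull_perturbed_interior_point[OF assms(2,4) q0D(2) r(1)] .
  have evball: "\<forall>\<^sub>F \<epsilon> in at_right 0. p + eps_vec \<epsilon> \<in> ball q0 r" if "dist p q0 < r" for p
  proof (rule topological_tendstoD)
    show "((\<lambda>\<epsilon>. p + eps_vec \<epsilon>) \<longlongrightarrow> p + 0) (at_right 0)"
      by (intro tendsto_intros tendsto_eps_vec)
  qed (use that in \<open>auto simp: dist_commute\<close>)

  have "\<forall>B\<in>\<B>. \<forall>B'\<in>\<B>. \<exists>k. \<forall>\<^sub>F \<epsilon> in at_right 0. aff_dim (?C B \<inter> ?C B' \<inter> ?S \<epsilon>) = k"
    using eventually_aff_dim_compl_cones by (auto simp: \<B>_def)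
  \<comment> \<open>The eventual dimensions are fixed before \<epsilon> is chosen, so measuring a
    slice at the chosen \<epsilon> reveals its eventual dimension.\<close>
  then obtain d where d: "\<And>B B'. B \<in> \<B> \<Longrightarrow> B' \<in> \<B> \<Longrightarrow>
      \<forall>\<^sub>F \<epsilon> in at_right 0. aff_dim (?C B \<inter> ?C B' \<inter> ?S \<epsilon>) = d B B'"
    by metis
  have "\<forall>\<^sub>F \<epsilon> in at_right 0. \<forall>B\<in>\<B>. \<forall>B'\<in>\<B>. aff_dim (?C B \<inter> ?C B' \<inter> ?S \<epsilon>) = d B B'"
    using d by (intro eventually_ball_finite ballI) auto
  moreover have "\<forall>\<^sub>F \<epsilon> in at_right 0. \<forall>J\<in>UNIV. span (Acol M ` J) \<inter> ?S \<epsilon> \<noteq> {} \<longrightarrow>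
      (\<forall>x. \<exists>l\<in>span (Acol M ` J). \<exists>v\<in>range ((*v) Q). x = l + v)"
    by (intro eventually_ball_finite ballI eventually_Seps_transversal) auto
  ultimately have "\<forall>\<^sub>F \<epsilon> in at_right 0.
      (\<forall>B\<in>\<B>. \<forall>B'\<in>\<B>. aff_dim (?C B \<inter> ?C B' \<inter> ?S \<epsilon>) = d B B') \<and>
      (\<forall>J\<in>UNIV. span (Acol M ` J) \<inter> ?S \<epsilon> \<noteq> {} \<longrightarrow>
        (\<forall>x. \<exists>l\<in>span (Acol M ` J). \<exists>v\<in>range ((*v) Q). x = l + v)) \<and>
      p1 + eps_vec \<epsilon> \<in> interior (?C B1) \<and> p2 + eps_vec \<epsilon> \<in> interior (?C B2) \<and>
      p1 + eps_vec \<epsilon> \<in> ball q0 r \<and> p2 + eps_vec \<epsilon> \<in> ball q0 r"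
    using p1(3) p2(3) evball[OF p1(2)] evball[OF p2(2)] by (intro eventually_conj)
  then obtain \<epsilon> where
    dim: "\<And>B B'. B \<in> \<B> \<Longrightarrow> B' \<in> \<B> \<Longrightarrow> aff_dim (?C B \<inter> ?C B' \<inter> ?S \<epsilon>) = d B B'" and
    tr: "\<And>J. span (Acol M ` J) \<inter> ?S \<epsilon> \<noteq> {} \<Longrightarrow>
      \<forall>x. \<exists>l\<in>span (Acol M ` J). \<exists>v\<in>range ((*v) Q). x = l + v" and
    pint: "p1 + eps_vec \<epsilon> \<in> interior (?C B1)" "p2 + eps_vec \<epsilon> \<in> interior (?C B2)"
      "p1 + eps_vec \<epsilon> \<in> ball q0 r" "p2 + eps_vec \<epsilon> \<in> ball q0 r"
    using eventually_happens'[OF trivial_limit_at_right_real] by blast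
  have pS: "p1 + eps_vec \<epsilon> \<in> ?S \<epsilon>" "p2 + eps_vec \<epsilon> \<in> ?S \<epsilon>"
    using p1(1) p2(1) by (auto simp: Seps_def)
  obtain x1 x2 where x: "x1 \<in> interior (?C B1) \<inter> ball q0 r" "x2 \<in> interior (?C B2) \<inter> ball q0 r"
    "closed_segment x1 x2 \<subseteq> ?S \<epsilon>"
    "\<And>J x. card J + 2 \<le> CARD('n) \<Longrightarrow> x \<in> closed_segment x1 x2 \<Longrightarrow> x \<notin> span (Acol M ` J)"
  proof (rule generic_segment[OF tr])
    show "convex (interior (?C B1) \<inter> ball q0 r)" "convex (interior (?C B2) \<inter> ball q0 r)"
      using closed_convex_compl_cone(2) cb by (auto intro!: convex_Int convex_interior)
    show "?S \<epsilon> \<inter> (interior (?C B1) \<inter> ball q0 r) \<noteq> {}" "?S \<epsilon> \<inter> (interior (?C B2) \<inter> ball q0 r) \<noteq> {}"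
      using pS pint by blast+
  qed auto
  have segball: "closed_segment x1 x2 \<subseteq> ball q0 r"
    using x(1,2) by (intro closed_segment_subset) auto
  have "(crossing M x1 x2)\<^sup>*\<^sup>* B1 B2"
    by (rule crossing_path[OF assms(1) cb _ _ x(4)]) (use x(1,2) in auto)
  from rtranclp_imp_list[OF this] obtain Bs where Bs: "Bs \<noteq> []" "hd Bs = B1" "last Bs = B2"
    "\<forall>k. k + 1 < length Bs \<longrightarrow> crossing M x1 x2 (Bs ! k) (Bs ! (k + 1))"
    by (elim exE conjE) (rule that)
  have trav: "traversed M x1 x2 (Bs ! k)" if "k < length Bs" for k
  proof (cases k)
    case 0
    then show ?thesis using Bs(1,2) x(1) cb(1) by (auto simp: traversed_def hd_conv_nth[symmetric])
  next
    case (Suc m)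
    then show ?thesis using Bs(4)[rule_format, of m] that by (simp add: crossing_def)
  qed
  have V: "B \<in> Veps M Q q" if "traversed M x1 x2 B" for B
  proof -
    have B: "B \<in> \<B>" using that by (simp add: traversed_def \<B>_def)
    have "?S \<epsilon> \<inter> interior (?C B) \<noteq> {}" using that x(3) by (auto simp: traversed_def)
    then have "aff_dim (?S \<epsilon> \<inter> ?C B) = int CARD('d)"
      using aff_dim_convex_Int_nonempty_interior[OF affine_imp_convex[OF affine_Seps]] aff_dim_Seps[OF assms(2)]
      by metis
    then have "d B B = int CARD('d)" using dim[OF B B] by (simp add: Int_commute)
    then show ?thesis using d[OF B B] B by (simp add: Veps_alt \<B>_def)
  qed
  have E: "{B, B'} \<in> Eeps M Q q" if cr: "crossing M x1 x2 B B'" for B B'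
  proof -
    obtain a p u \<rho> where c: "traversed M x1 x2 B" "traversed M x1 x2 B'" "0 < \<rho>"
      "p \<in> closed_segment x1 x2" "a \<bullet> p = 0" "u \<in> closed_segment x1 x2" "u \<in> ?C B'" "a \<bullet> u < 0"
      "\<forall>x\<in>ball p \<rho>. a \<bullet> x = 0 \<longrightarrow> x \<in> ?C B \<inter> ?C B'"
      "\<forall>x\<in>?C B. 0 \<le> a \<bullet> x" "\<forall>x\<in>?C B'. a \<bullet> x \<le> 0"
      using cr unfolding crossing_def by blast
    let ?H = "?S \<epsilon> \<inter> {x. a \<bullet> x = 0}"
    have BB: "B \<in> \<B>" "B' \<in> \<B>" using c(1,2) by (auto simp: traversed_def \<B>_def)
    \<comment> \<open>\<open>u\<close> lies in the second cone, on the side of \<open>a\<close> that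
      the first cone avoids.\<close>
    have "B \<noteq> B'" using c(7,8,10) by force
    have pH: "p \<in> ?H" using c(4,5) x(3) by auto
    have "u \<in> ?S \<epsilon>" "a \<bullet> u \<noteq> 0" using c(6,8) x(3) by auto
    \<comment> \<open>The hyperplane contains \<open>p\<close> but not \<open>u\<close>, both in the
      perturbed space, so it lowers the dimension by exactly one.\<close>
    then have dimH: "aff_dim ?H = int CARD('d) - 1"
      using aff_dim_affine_Int_hyperplane[OF affine_Seps, of Q q \<epsilon> a 0] pH aff_dim_Seps[OF assms(2), of q \<epsilon>]
      by auto
    have "convex ?H" by (intro convex_Int affine_imp_convex affine_Seps affine_hyperplane)
    then have "aff_dim (?H \<inter> ball p \<rho>) = aff_dim ?H"
      using pH c(3) by (intro aff_dim_convex_Int_open) auto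
    \<comment> \<open>The common part of the cones contains a neighbourhood of \<open>p\<close> in
      \<open>?H\<close>, and its slice lies in \<open>?H\<close> because \<open>a\<close> has
      opposite signs on the two cones.\<close>
    moreover have "aff_dim (?H \<inter> ball p \<rho>) \<le> aff_dim (?C B \<inter> ?C B' \<inter> ?S \<epsilon>)"
      using c(9) by (intro aff_dim_subset) auto
    moreover have "aff_dim (?C B \<inter> ?C B' \<inter> ?S \<epsilon>) \<le> aff_dim ?H"
      using c(10,11) by (intro aff_dim_subset) (auto intro: antisym)
    ultimately have "d B B' = int CARD('d) - 1" using dim[OF BB] dimH by simp
    then have "\<forall>\<^sub>F \<epsilon> in at_right 0. aff_dim (?C B \<inter> ?C B' \<inter> ?S \<epsilon>) = int CARD('d) - 1"
      using d[OF BB] by simp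
    then show ?thesis
      using V[OF c(1)] V[OF c(2)] \<open>B \<noteq> B'\<close> unfolding Eeps_def eventually_at_right_0_iff by blast
  qed
  have D: "aff_dim (crit_dom M Q q B \<inter> crit_dom M Q q B1 \<inter> crit_dom M Q q B2) = int CARD('d) - 1"
    if tv: "traversed M x1 x2 B" for B
  proof -
    have B: "B \<in> \<B>" using tv by (simp add: traversed_def \<B>_def)
    obtain z where "z \<in> interior (?C B)" "z \<in> closed_segment x1 x2"
      using tv by (auto simp: traversed_def)
    then have "q0 \<in> ?C B" using near[OF B] segball interior_subset[of "?C B"] by blast
    moreover have "crit_dom M Q q B \<inter> crit_dom M Q q B1 \<inter> crit_dom M Q q B2 = ?C B \<inter> F"
      by (auto simp: F_def crit_dom_def)
    ultimately show ?thesis using dim_q0[OF B] by simp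
  qed
  have "\<forall>k < length Bs. Bs ! k \<in> Veps M Q q" using V trav by blast
  moreover have "\<forall>k. k + 1 < length Bs \<longrightarrow> {Bs ! k, Bs ! (k + 1)} \<in> Eeps M Q q"
    using E Bs(4) by blast
  moreover have "\<forall>k < length Bs. aff_dim (crit_dom M Q q (Bs ! k) \<inter> crit_dom M Q q B1
      \<inter> crit_dom M Q q B2) = int CARD('d) - 1"
    using D trav by blast
  ultimately show ?thesis using Bs(1-3) by (intro exI[of _ Bs] conjI)
qed

end
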